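(* Let $U$ be an open convex subset of a Banach space $X$ such that the dual space $X^{*}$ has an equivalent locally uniformly rotund (LUR) norm. Then, for every $\varepsilon > 0$ and every continuous and convex function $f : U \to \mathbb{R}$, there exists a convex function $g : U \to \mathbb{R}$ of class $C^1(U)$ such that $f - \varepsilon \leq g \leq f$ on $U$.
   Context: $X^{*}$ denotes the dual space of the Banach space $X$. A norm $\|\cdot\|$ on a Banach space $Y$ is locally uniformly rotund (LUR) if whenever $y, y_n \in Y$ satisfy $\|y\| = \|y_n\| = 1$ for all $n$ and $\|y + y_n\| \to 2$, one has $\|y_n - y\| \to 0$. An equivalent norm on $Y$ is a norm inducing the same topology as the original norm of $Y$. A function is of class $C^1(U)$ if it is Fréchet differentiable at every point of $U$ with continuous derivative. The function $f$ is not assumed to be bounded on bounded sets.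
   Formalization: The equivalent LUR norm on X* is required to be the dual norm of an equivalent norm on X; for arbitrary equivalent norms on X* the claim fails (Haydon's C_0(T), whose dual l^1(T) has an equivalent LUR norm although C_0(T) has no equivalent Gateaux smooth norm). *)

theory Defs
  imports "HOL-Analysis.Analysis"
begin

definition is_norm :: "('a::real_vector \<Rightarrow> real) \<Rightarrow> bool" where
  "is_norm N \<longleftrightarrow>
     (\<forall>x. 0 \<le> N x) \<and>
     (\<forall>x. N x = 0 \<longleftrightarrow> x = 0) \<and>
     (\<forall>c x. N (c *\<^sub>R x) = \<bar>c\<bar> * N x) \<and>
     (\<forall>x y. N (x + y) \<le> N x + N y)"

definition equivalent_norm :: "('a::real_normed_vector \<Rightarrow> real) \<Rightarrow> bool" where
  "equivalent_norm N \<longleftrightarrow>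
     is_norm N \<and> Metric_space.mtopology UNIV (\<lambda>x y. N (x - y)) = euclidean"

definition LUR :: "('a::real_normed_vector \<Rightarrow> real) \<Rightarrow> bool" where
  "LUR N \<longleftrightarrow>
     (\<forall>y Y. N y = 1 \<and> (\<forall>n::nat. N (Y n) = 1) \<and> (\<lambda>n. N (y + Y n)) \<longlonglongrightarrow> 2
        \<longrightarrow> (\<lambda>n. N (Y n - y)) \<longlonglongrightarrow> 0)"

definition dual_norm :: "('a::real_normed_vector \<Rightarrow> real) \<Rightarrow> ('a \<Rightarrow>\<^sub>L real) \<Rightarrow> real" where
  "dual_norm p \<phi> = (SUP x\<in>{x. p x \<le> 1}. \<bar>blinfun_apply \<phi> x\<bar>)"

(* An equivalent norm on the dual space X* of X = 'a is, as usual in renorming theory,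
   the dual of an equivalent norm on X. For an equivalent norm on the mere Banach space X*,
   LUR would not suffice for smooth approximation: if T is a full uncountably branching tree
   of height omega_1, the dual of C_0(T) is l^1(T), which is LUR under
   (|x|_1^2 + |x|_2^2)^(1/2), but C_0(T) has no equivalent Gateaux smooth norm (Haydon). *)
definition equivalent_dual_norm :: "(('a::real_normed_vector \<Rightarrow>\<^sub>L real) \<Rightarrow> real) \<Rightarrow> bool" where
  "equivalent_dual_norm N \<longleftrightarrow>
     equivalent_norm N \<and> (\<exists>p::'a \<Rightarrow> real. equivalent_norm p \<and> N = dual_norm p)"

definition C1_on :: "'a::real_normed_vector set \<Rightarrow> ('a \<Rightarrow> 'b::real_normed_vector) \<Rightarrow> bool" where
  "C1_on U g \<longleftrightarrow>
     (\<exists>g'::'a \<Rightarrow> 'a \<Rightarrow>\<^sub>L 'b.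
        (\<forall>x\<in>U. (g has_derivative blinfun_apply (g' x)) (at x)) \<and> continuous_on U g')"

end

theory Submission
  imports Defs
begin

text \<open>
  The proof has two halves: smoothing when \<open>f\<close> is Lipschitz on the whole space, and a reduction of
  the general case to that one.

  Lipschitz case. Let \<open>p\<close> be an equivalent norm whose dual norm \<open>N\<close> is LUR, and let
  \<open>F x\<close> be the infimum of \<open>h y + c * (p (x - y))\<^sup>2\<close> over all \<open>y\<close>. If \<open>h\<close> is convex and
  \<open>L\<close>-Lipschitz for \<open>p\<close>, then so is \<open>F\<close>, and \<open>h - L\<^sup>2 / (4 * c) \<le> F \<le> h\<close>. By Hahn-Banach every
  point \<open>x\<close> carries a subgradient \<open>\<xi> x\<close> of \<open>F\<close>, and a convex function with a norm-continuous
  selection of subgradients is \<open>C\<^sup>1\<close>; so everything hinges on the continuity of \<open>\<xi>\<close>. A near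
  minimiser \<open>y\<close> of the infimum at \<open>x\<close> forces every approximate subgradient \<open>\<zeta>\<close> of \<open>F\<close> at \<open>x\<close> to
  have \<open>N \<zeta>\<close> close to \<open>2 * c * p (x - y)\<close>
  (\<open>approximate_subgradient_dual_norm\<close>): this number does not depend on \<open>\<zeta>\<close>. For
  \<open>X n \<longlonglongrightarrow> x\<close> the functionals \<open>\<xi> x\<close>, \<open>\<xi> (X n)\<close> and their midpoint are all approximate
  subgradients at \<open>x\<close>, hence have asymptotically the same \<open>N\<close>-norm, and local uniform rotundity
  gives \<open>\<xi> (X n) \<longlonglongrightarrow> \<xi> x\<close>.

  Reduction. Let \<open>E k\<close> be the interior of the set of points from which \<open>f\<close> decreases with slope at
  most \<open>n0 + k\<close>. A continuous convex function has locally bounded slopes, so these open sets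
  increase to \<open>U\<close>. The infimal convolution of \<open>f\<close> with \<open>(n0 + k) * norm\<close> is a Lipschitz convex
  minorant of \<open>f\<close> that agrees with \<open>f\<close> on \<open>E k\<close>. Approximate it by a \<open>C\<^sup>1\<close> convex \<open>g k\<close>
  lying slightly lower for larger \<open>k\<close>, so that on \<open>E k\<close> the function \<open>g k\<close> beats all later ones by
  a margin. A smooth version of the supremum of all \<open>g k\<close> then involves only \<open>g 0\<close> up to \<open>g k\<close> on \<open>E k\<close>, hence is \<open>C\<^sup>1\<close>, while on each \<open>E k\<close> it is at
  least \<open>g k \<ge> f - \<epsilon>\<close> (\<open>convex_C1_gluing\<close>).
\<close>

section \<open>Linear minorants and subgradients\<close>

text \<open>
  Positive homogeneity is recorded only as an inequality for positive factors; scaling back by the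
  inverse factor yields equality (\<open>sublinear_scale\<close>).
\<close>
definition sublinear :: "('a::real_vector \<Rightarrow> real) \<Rightarrow> bool" where
  "sublinear q \<longleftrightarrow> (\<forall>x y. q (x + y) \<le> q x + q y) \<and> (\<forall>c>0. \<forall>x. q (c *\<^sub>R x) \<le> c * q x)"

lemma sublinear_zero:
  assumes "sublinear q" shows "q 0 = 0"
proof -
  have "q (2 *\<^sub>R 0) \<le> 2 * q 0" "q ((1/2) *\<^sub>R 0) \<le> (1/2) * q 0"
    using assms unfolding sublinear_def by (metis zero_less_numeral half_gt_zero_iff zero_less_one)+
  then show ?thesis by simp
qed

lemma sublinear_scale:
  assumes "sublinear q" and "0 < c" shows "q (c *\<^sub>R x) = c * q x"
proof (rule antisym)
  show "q (c *\<^sub>R x) \<le> c * q x" using assms by (simp add: sublinear_def)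
  have "q (inverse c *\<^sub>R (c *\<^sub>R x)) \<le> inverse c * q (c *\<^sub>R x)"
    using assms unfolding sublinear_def by (metis positive_imp_inverse_positive)
  then show "c * q x \<le> q (c *\<^sub>R x)" using assms(2) by (simp add: field_simps)
qed

lemma sublinear_ge_neg:
  assumes "sublinear q" shows "- q (- x) \<le> q x"
proof -
  have "q (x + - x) \<le> q x + q (- x)" using assms unfolding sublinear_def by blast
  then show ?thesis using sublinear_zero[OF assms] by simp
qed

text \<open>
  Gives the lower bounds of chains in the application of Zorn's lemma below. Subadditivity of the
  infimum needs the chain condition: two members used at \<open>x\<close> and at \<open>y\<close> are replaced by the
  smaller of the two.
\<close>
lemma sublinear_chain_inf:
  assumes "C \<noteq> {}" and subl: "\<And>s. s \<in> C \<Longrightarrow> sublinear s"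
    and le: "\<And>s x. s \<in> C \<Longrightarrow> s x \<le> q x"
    and chain: "\<And>s t. s \<in> C \<Longrightarrow> t \<in> C \<Longrightarrow> s \<le> t \<or> t \<le> s"
  shows "sublinear (\<lambda>x. INF s\<in>C. s x)" and "s \<in> C \<Longrightarrow> (INF s\<in>C. s x) \<le> s x"
proof -
  have bdd: "bdd_below ((\<lambda>s. s x) ` C)" for x
  proof (rule bdd_belowI2)
    fix s assume "s \<in> C"
    then show "- q (- x) \<le> s x" using sublinear_ge_neg[OF subl, of s x] le[of s "- x"] by simp
  qed
  show low: "(INF s\<in>C. s x) \<le> s x" if "s \<in> C" for s x
    using bdd that by (rule cINF_lower)
  show "sublinear (\<lambda>x. INF s\<in>C. s x)"
    unfolding sublinear_def
  proof (intro conjI allI impI)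
    fix x y
    have *: "(INF s\<in>C. s (x + y)) \<le> s x + t y" if s: "s \<in> C" and t: "t \<in> C" for s t
    proof -
      obtain r where r: "r \<in> C" "r \<le> s" "r \<le> t" using chain[OF s t] s t by blast
      have "(INF s\<in>C. s (x + y)) \<le> r (x + y)" using r(1) by (rule low)
      also have "\<dots> \<le> r x + r y" using subl[OF r(1)] by (simp add: sublinear_def)
      also have "\<dots> \<le> s x + t y" using r by (simp add: add_mono le_funD)
      finally show ?thesis .
    qed
    have "(INF s\<in>C. s (x + y)) - t y \<le> (INF s\<in>C. s x)" if "t \<in> C" for t
      using *[OF _ that] assms(1) by (intro cINF_greatest) (auto simp: algebra_simps)
    then have "(INF s\<in>C. s (x + y)) - (INF s\<in>C. s x) \<le> (INF s\<in>C. s y)"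
      using assms(1) by (intro cINF_greatest) (auto simp: algebra_simps)
    then show "(INF s\<in>C. s (x + y)) \<le> (INF s\<in>C. s x) + (INF s\<in>C. s y)" by simp
  next
    fix c :: real and x assume c: "0 < c"
    have "(INF s\<in>C. s (c *\<^sub>R x)) / c \<le> (INF s\<in>C. s x)"
    proof (rule cINF_greatest[OF assms(1)])
      fix s assume "s \<in> C"
      then show "(INF s\<in>C. s (c *\<^sub>R x)) / c \<le> s x"
        using low[of s "c *\<^sub>R x"] sublinear_scale[OF subl c, of s x] c by (simp add: field_simps)
    qed
    then show "(INF s\<in>C. s (c *\<^sub>R x)) \<le> c * (INF s\<in>C. s x)" using c by (simp add: field_simps)
  qed
qed

text \<open>
  Pushing a sublinear \<open>m\<close> down along the ray of \<open>y\<close> keeps it sublinear and makes its value at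
  \<open>- y\<close> at most \<open>- m y\<close> (take \<open>t = 1\<close>). Hence a minimal sublinear functional is odd.
\<close>
lemma sublinear_directional:
  fixes m :: "'a::real_vector \<Rightarrow> real"
  assumes m: "sublinear m"
  defines "d \<equiv> \<lambda>y x. INF t\<in>{0::real..}. m (x + t *\<^sub>R y) - t * m y"
  shows "sublinear (d y)" and "0 \<le> t \<Longrightarrow> d y x \<le> m (x + t *\<^sub>R y) - t * m y"
proof -
  have hom: "m (t *\<^sub>R y) = t * m y" if "0 \<le> t" for t y
    using that sublinear_scale[OF m, of t y] sublinear_zero[OF m] by (cases "t = 0") auto
  have sub: "m (x + y) \<le> m x + m y" for x y using m by (simp add: sublinear_def)
  have bdd: "bdd_below ((\<lambda>t. m (x + t *\<^sub>R y) - t * m y) ` {0..})" for x y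
  proof (rule bdd_belowI2)
    fix t :: real assume "t \<in> {0..}"
    then have "t * m y \<le> m (x + t *\<^sub>R y) + m (- x)"
      using sub[of "x + t *\<^sub>R y" "- x"] hom[of t y] by simp
    then show "- m (- x) \<le> m (x + t *\<^sub>R y) - t * m y" by simp
  qed
  show low: "d y x \<le> m (x + t *\<^sub>R y) - t * m y" if "0 \<le> t" for t x y
    unfolding d_def by (rule cINF_lower[OF bdd]) (use that in simp)
  have great: "b \<le> d y x" if "\<And>t. 0 \<le> t \<Longrightarrow> b \<le> m (x + t *\<^sub>R y) - t * m y" for b x y
    unfolding d_def by (rule cINF_greatest) (use that in auto)
  show "sublinear (d y)"
    unfolding sublinear_def
  proof (intro conjI allI impI)
    fix u v
    have "d y (u + v) - (m (v + s *\<^sub>R y) - s * m y) \<le> d y u" if s: "0 \<le> s" for s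
    proof (rule great)
      fix t :: real assume t: "0 \<le> t"
      have "d y (u + v) \<le> m ((u + v) + (t + s) *\<^sub>R y) - (t + s) * m y"
        using s t by (intro low) simp
      also have "(u + v) + (t + s) *\<^sub>R y = (u + t *\<^sub>R y) + (v + s *\<^sub>R y)"
        by (simp add: algebra_simps)
      also have "m \<dots> \<le> m (u + t *\<^sub>R y) + m (v + s *\<^sub>R y)" by (rule sub)
      finally show "d y (u + v) - (m (v + s *\<^sub>R y) - s * m y) \<le> m (u + t *\<^sub>R y) - t * m y"
        by (simp add: algebra_simps)
    qed
    then have "d y (u + v) - d y u \<le> d y v"
      by (intro great) (simp add: algebra_simps)
    then show "d y (u + v) \<le> d y u + d y v" by simp
  next
    fix c :: real and x assume c: "0 < c"
    have "d y (c *\<^sub>R x) / c \<le> d y x"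
    proof (rule great)
      fix t :: real assume t: "0 \<le> t"
      have "d y (c *\<^sub>R x) \<le> m (c *\<^sub>R x + (c * t) *\<^sub>R y) - (c * t) * m y"
        using c t by (intro low) simp
      also have "m (c *\<^sub>R x + (c * t) *\<^sub>R y) = c * m (x + t *\<^sub>R y)"
        using hom[of c "x + t *\<^sub>R y"] c by (simp add: algebra_simps)
      finally show "d y (c *\<^sub>R x) / c \<le> m (x + t *\<^sub>R y) - t * m y"
        using c by (simp add: field_simps)
    qed
    then show "d y (c *\<^sub>R x) \<le> c * d y x" using c by (simp add: field_simps)
  qed
qed

text \<open>
  Hahn-Banach in its simplest form: below \<open>q\<close> there is a minimal sublinear functional, which is odd
  and therefore linear.
\<close>
lemma sublinear_dominates_linear:
  assumes q: "sublinear q"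
  shows "\<exists>l. linear l \<and> (\<forall>x. l x \<le> q x)"
proof -
  define A where "A = {s. sublinear s \<and> s \<le> q}"
  let ?P = "\<lambda>s t. (t::'a \<Rightarrow> real) \<le> s"
  have "\<exists>m\<in>A. \<forall>a\<in>A. ?P m a \<longrightarrow> a = m"
  proof (rule predicate_Zorn)
    show "partial_order_on A (relation_of ?P A)"
      by (rule partial_order_on_relation_ofI) auto
    fix C assume C: "C \<in> Chains (relation_of ?P A)"
    show "\<exists>u\<in>A. \<forall>a\<in>C. ?P a u"
    proof (cases "C = {}")
      case True
      then show ?thesis using q unfolding A_def by auto
    next
      case False
      have CA: "C \<subseteq> A" and ch: "\<And>s t. s \<in> C \<Longrightarrow> t \<in> C \<Longrightarrow> s \<le> t \<or> t \<le> s"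
        using C unfolding Chains_def relation_of_def by auto
      have sl: "sublinear s" and sq: "s x \<le> q x" if "s \<in> C" for s x
        using that CA unfolding A_def by (auto simp: le_fun_def)
      define u where "u = (\<lambda>x. INF s\<in>C. s x)"
      have u: "sublinear u" "\<And>s x. s \<in> C \<Longrightarrow> u x \<le> s x"
        unfolding u_def
        by (rule sublinear_chain_inf[of C q]; use False sl sq ch in blast)+
      obtain s where "s \<in> C" using False by blast
      then have "u \<le> q" using u(2)[of s] sq[of s] by (meson le_funI order_trans)
      then have "u \<in> A" unfolding A_def using u(1) by simp
      moreover have "\<forall>a\<in>C. u \<le> a" using u(2) by (auto simp: le_fun_def)
      ultimately show ?thesis by blast
    qed
  qed
  then obtain m where m: "sublinear m" "m \<le> q" and min: "\<And>a. sublinear a \<Longrightarrow> a \<le> m \<Longrightarrow> a = m"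
    unfolding A_def by (metis (mono_tags, lifting) mem_Collect_eq order_trans)
  have hom: "m (t *\<^sub>R y) = t * m y" if "0 \<le> t" for t y
    using that sublinear_scale[OF m(1), of t y] sublinear_zero[OF m(1)] by (cases "t = 0") auto
  have neg: "m (- y) = - m y" for y
  proof -
    define d where "d = (\<lambda>x. INF t\<in>{0::real..}. m (x + t *\<^sub>R y) - t * m y)"
    have d: "sublinear d" "\<And>t x. 0 \<le> t \<Longrightarrow> d x \<le> m (x + t *\<^sub>R y) - t * m y"
      unfolding d_def using sublinear_directional[OF m(1)] by blast+
    have "d \<le> m" using d(2)[of 0] by (simp add: le_fun_def)
    then have "d = m" using min d(1) by blast
    then have "m (- y) \<le> - m y"
      using d(2)[of 1 "- y"] sublinear_zero[OF m(1)] by simp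
    then show ?thesis using sublinear_ge_neg[OF m(1), of "- y"] by simp
  qed
  have sub: "m (x + y) \<le> m x + m y" for x y using m(1) by (simp add: sublinear_def)
  have "linear m"
  proof (rule linearI)
    show "m (x + y) = m x + m y" for x y
      using sub[of x y] sub[of "x + y" "- y"] neg[of y] by simp
    show "m (c *\<^sub>R x) = c *\<^sub>R m x" for c x
    proof (cases "0 \<le> c")
      case False
      then have "m (- ((- c) *\<^sub>R x)) = c * m x" unfolding neg using hom[of "- c" x] by simp
      then show ?thesis by simp
    qed (simp add: hom)
  qed
  then show ?thesis using m(2) by (auto simp: le_fun_def)
qed

text \<open>
  The \<open>e\<close>-subdifferential of convex analysis; the error \<open>e\<close> allows comparing subgradients taken at
  different points.
\<close>
definition subgradient :: "('a::real_normed_vector \<Rightarrow> real) \<Rightarrow> 'a \<Rightarrow> real \<Rightarrow> ('a \<Rightarrow>\<^sub>L real) \<Rightarrow> bool" where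
  "subgradient F x e \<xi> \<longleftrightarrow> (\<forall>z. F x + blinfun_apply \<xi> (z - x) - e \<le> F z)"

text \<open>
  The one-sided directional derivative of \<open>F\<close> at \<open>x\<close> is sublinear, and a linear functional below it
  is a subgradient.
\<close>
lemma Lipschitz_convex_subgradient:
  fixes F :: "'a::real_normed_vector \<Rightarrow> real"
  assumes F: "convex_on UNIV F" and L: "0 \<le> L" "\<And>x y. F x \<le> F y + L * norm (x - y)"
  shows "\<exists>\<xi>. subgradient F x 0 \<xi> \<and> norm \<xi> \<le> L"
proof -
  define q where "q = (\<lambda>v. INF t\<in>{0::real<..}. (F (x + t *\<^sub>R v) - F x) / t)"
  have bdd: "bdd_below ((\<lambda>t. (F (x + t *\<^sub>R v) - F x) / t) ` {0<..})" for v
  proof (rule bdd_belowI2)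
    fix t :: real assume "t \<in> {0<..}"
    then show "- (L * norm v) \<le> (F (x + t *\<^sub>R v) - F x) / t"
      using L(2)[of x "x + t *\<^sub>R v"] by (simp add: field_simps)
  qed
  have low: "q v \<le> (F (x + t *\<^sub>R v) - F x) / t" if "0 < t" for t v
    unfolding q_def by (rule cINF_lower[OF bdd]) (use that in simp)
  have great: "b \<le> q v" if "\<And>t. 0 < t \<Longrightarrow> b \<le> (F (x + t *\<^sub>R v) - F x) / t" for b v
    unfolding q_def by (rule cINF_greatest) (use that in auto)
  have "sublinear q"
    unfolding sublinear_def
  proof (intro conjI allI impI)
    fix u v
    have "q (u + v) - (F (x + s *\<^sub>R v) - F x) / s \<le> q u" if s: "0 < s" for s
    proof (rule great)
      fix t :: real assume t: "0 < t"
      \<comment> \<open>Half the harmonic mean of the two step lengths turns a step along \<open>u + v\<close> into a convex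
        combination of a step of length \<open>t\<close> along \<open>u\<close> and one of length \<open>s\<close> along \<open>v\<close>.\<close>
      define r where "r = t * s / (t + s)"
      have r: "0 < r" using s t by (simp add: r_def)
      have rt: "r / t = s / (t + s)" and rs: "r / s = t / (t + s)"
        using s t by (simp_all add: r_def)
      have one: "r / t + r / s = 1" unfolding rt rs add_divide_distrib[symmetric] using s t by simp
      have "x + r *\<^sub>R (u + v) = (r / t + r / s) *\<^sub>R x + r *\<^sub>R (u + v)" by (simp add: one)
      also have "\<dots> = (r / t) *\<^sub>R (x + t *\<^sub>R u) + (r / s) *\<^sub>R (x + s *\<^sub>R v)"
        using s t by (simp add: algebra_simps)
      finally have "F (x + r *\<^sub>R (u + v)) \<le> (r / t) * F (x + t *\<^sub>R u) + (r / s) * F (x + s *\<^sub>R v)"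
        using F one r s t unfolding convex_on_def by (simp only:) (simp del: times_divide_eq_left)
      moreover have "F x = (r / t) * F x + (r / s) * F x" using one by (metis distrib_right mult_1)
      ultimately have "F (x + r *\<^sub>R (u + v)) - F x
          \<le> (r / t) * (F (x + t *\<^sub>R u) - F x) + (r / s) * (F (x + s *\<^sub>R v) - F x)"
        by (simp add: right_diff_distrib)
      then have "F (x + r *\<^sub>R (u + v)) - F x
          \<le> r * ((F (x + t *\<^sub>R u) - F x) / t + (F (x + s *\<^sub>R v) - F x) / s)"
        by (simp add: distrib_left)
      then have "(F (x + r *\<^sub>R (u + v)) - F x) / r
          \<le> (F (x + t *\<^sub>R u) - F x) / t + (F (x + s *\<^sub>R v) - F x) / s"
        using r by (simp add: pos_divide_le_eq mult.commute)
      then show "q (u + v) - (F (x + s *\<^sub>R v) - F x) / s \<le> (F (x + t *\<^sub>R u) - F x) / t"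
        using low[OF r, of "u + v"] by simp
    qed
    then have "q (u + v) - q u \<le> q v"
      by (intro great) (simp add: algebra_simps)
    then show "q (u + v) \<le> q u + q v" by simp
  next
    fix c :: real and v assume c: "0 < c"
    have "q (c *\<^sub>R v) / c \<le> q v"
    proof (rule great)
      fix t :: real assume t: "0 < t"
      show "q (c *\<^sub>R v) / c \<le> (F (x + t *\<^sub>R v) - F x) / t"
        using low[of "t / c" "c *\<^sub>R v"] c t by (simp add: field_simps)
    qed
    then show "q (c *\<^sub>R v) \<le> c * q v" using c by (simp add: field_simps)
  qed
  then obtain l where l: "linear l" "\<And>v. l v \<le> q v"
    using sublinear_dominates_linear by blast
  have up: "l v \<le> F (x + v) - F x" for v using l(2)[of v] low[of 1 v] by simp
  have upL: "l v \<le> L * norm v" for v using up[of v] L(2)[of "x + v" x] by simp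
  have abs: "\<bar>l v\<bar> \<le> L * norm v" for v
    using upL[of v] upL[of "- v"] linear_neg[OF l(1), of v] by auto
  have bl: "bounded_linear l"
    using l(1) abs by (intro bounded_linear_intro[where K = L])
      (auto simp: linear_add linear_scale mult.commute)
  have "subgradient F x 0 (Blinfun l)"
    unfolding subgradient_def bounded_linear_Blinfun_apply[OF bl]
    using up by (metis add.commute add_diff_cancel_left' diff_add_cancel diff_zero le_diff_eq)
  moreover have "norm (Blinfun l) \<le> L"
    using abs L(1) by (intro norm_blinfun_bound) (auto simp: bounded_linear_Blinfun_apply[OF bl])
  ultimately show ?thesis by blast
qed

section \<open>Equivalent norms, dual norms and local uniform rotundity\<close>

lemma is_normD:
  assumes "is_norm p"
  shows "0 \<le> p x" and "p x = 0 \<longleftrightarrow> x = 0" and "p (c *\<^sub>R x) = \<bar>c\<bar> * p x"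
    and "p (x + y) \<le> p x + p y" and "p (- x) = p x" and "p (x - y) = p (y - x)"
    and "x \<noteq> 0 \<Longrightarrow> 0 < p x"
proof -
  show nonneg: "0 \<le> p x" and zero: "p x = 0 \<longleftrightarrow> x = 0" and "p (c *\<^sub>R x) = \<bar>c\<bar> * p x"
    and "p (x + y) \<le> p x + p y" for x y c
    using assms unfolding is_norm_def by blast+
  show neg: "p (- x) = p x" for x
    using assms unfolding is_norm_def by (metis abs_1 abs_minus mult_1 scaleR_minus1_left)
  show "p (x - y) = p (y - x)" using neg[of "x - y"] by simp
  show "x \<noteq> 0 \<Longrightarrow> 0 < p x" using nonneg[of x] zero[of x] by linarith
qed

text \<open>
  Each unit ball contains a small ball of the other norm, and homogeneity does the rest.
\<close>
lemma equivalent_norm_bounds: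
  fixes p :: "'a::real_normed_vector \<Rightarrow> real"
  assumes "equivalent_norm p"
  shows "\<exists>a>0. \<forall>x. a * norm x \<le> p x" and "\<exists>b>0. \<forall>x. p x \<le> b * norm x"
proof -
  have p: "is_norm p" and top: "Metric_space.mtopology UNIV (\<lambda>x y. p (x - y)) = euclidean"
    using assms unfolding equivalent_norm_def by auto
  note nonneg = is_normD(1)[OF p] and zero = is_normD(2)[OF p] and scale = is_normD(3)[OF p]
    and tri = is_normD(4)[OF p] and comm = is_normD(6)[OF p]
  interpret Metric_space UNIV "\<lambda>x y. p (x - y)"
  proof
    show "p (x - z) \<le> p (x - y) + p (y - z)" for x y z using tri[of "x - y" "y - z"] by simp
  qed (use nonneg zero comm in auto)
  show "\<exists>a>0. \<forall>x. a * norm x \<le> p x"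
  proof -
    have "openin mtopology (ball 0 1)" unfolding top by simp
    then obtain r where r: "0 < r" "mball 0 r \<subseteq> ball 0 1"
      unfolding openin_mtopology by (meson centre_in_ball zero_less_one)
    have "r / 2 * norm x \<le> p x" for x
    proof (cases "x = 0")
      case False
      then have px: "0 < p x" by (rule is_normD(7)[OF p])
      have "p ((r / (2 * p x)) *\<^sub>R x) = r / 2" unfolding scale using px r(1) by simp
      moreover have "p (0 - v) = p v" for v using comm[of 0 v] by simp
      ultimately have "(r / (2 * p x)) *\<^sub>R x \<in> mball 0 r" using r(1) by simp
      then have "(r / (2 * p x)) *\<^sub>R x \<in> ball 0 1" using r(2) by blast
      then have "r / (2 * p x) * norm x < 1" using px r(1) by simp
      then show ?thesis using px by (simp add: field_simps)
    qed (simp add: is_normD(1)[OF p])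
    then show ?thesis using r(1) by (meson half_gt_zero)
  qed
  show "\<exists>b>0. \<forall>x. p x \<le> b * norm x"
  proof -
    have "openin mtopology (mball 0 1)" by simp
    then have "open (mball 0 1)" unfolding top by simp
    moreover have "0 \<in> mball 0 1" using is_normD(2)[OF p, of 0] by simp
    ultimately obtain r where r: "0 < r" "ball 0 r \<subseteq> mball 0 1"
      unfolding open_contains_ball by blast
    have "p x \<le> 2 / r * norm x" for x
    proof (cases "x = 0")
      case False
      then have nx: "0 < norm x" by simp
      have "(r / (2 * norm x)) *\<^sub>R x \<in> ball 0 r" using nx r(1) by simp
      then have "(r / (2 * norm x)) *\<^sub>R x \<in> mball 0 1" using r(2) by blast
      moreover have "p (0 - v) = p v" for v using comm[of 0 v] by simp
      ultimately have "r / (2 * norm x) * p x < 1" using nx r(1) scale by simp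
      then show ?thesis using nx r(1) by (simp add: field_simps)
    qed (use is_normD(2)[OF p, of 0] in simp)
    then show ?thesis using r(1) by (meson divide_pos_pos zero_less_numeral)
  qed
qed

lemma dual_norm_upper:
  fixes p :: "'a::real_normed_vector \<Rightarrow> real"
  assumes "equivalent_norm p" and "p x \<le> 1"
  shows "\<bar>blinfun_apply \<xi> x\<bar> \<le> dual_norm p \<xi>"
proof -
  obtain a where a: "0 < a" "\<And>x. a * norm x \<le> p x" using equivalent_norm_bounds(1)[OF assms(1)] by blast
  have "bdd_above ((\<lambda>x. \<bar>blinfun_apply \<xi> x\<bar>) ` {x. p x \<le> 1})"
  proof (rule bdd_aboveI2)
    fix x assume "x \<in> {x. p x \<le> 1}"
    then have "norm x \<le> 1 / a" using a(1) a(2)[of x] by (simp add: field_simps)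
    then have "norm \<xi> * norm x \<le> norm \<xi> * (1 / a)" by (rule mult_left_mono) simp
    then show "\<bar>blinfun_apply \<xi> x\<bar> \<le> norm \<xi> * (1 / a)"
      using norm_blinfun[of \<xi> x] by simp
  qed
  then show ?thesis unfolding dual_norm_def by (rule cSUP_upper[rotated]) (use assms(2) in simp)
qed

lemma dual_norm_ge:
  fixes p :: "'a::real_normed_vector \<Rightarrow> real"
  assumes p: "equivalent_norm p"
  shows "\<bar>blinfun_apply \<xi> x\<bar> \<le> dual_norm p \<xi> * p x"
proof -
  have n: "is_norm p" using p by (simp add: equivalent_norm_def)
  show ?thesis
  proof (cases "x = 0")
    case True
    then show ?thesis using is_normD(2)[OF n, of 0] by simp
  next
    case False
    have px: "0 < p x" using False by (rule is_normD(7)[OF n])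
    have "p ((1 / p x) *\<^sub>R x) = \<bar>1 / p x\<bar> * p x" by (rule is_normD(3)[OF n])
    then have "p ((1 / p x) *\<^sub>R x) = 1" using px by simp
    then have "\<bar>blinfun_apply \<xi> ((1 / p x) *\<^sub>R x)\<bar> \<le> dual_norm p \<xi>"
      by (intro dual_norm_upper[OF p]) simp
    then show ?thesis using px by (simp add: blinfun.scaleR_right abs_mult field_simps)
  qed
qed

lemma dual_norm_least:
  fixes p :: "'a::real_normed_vector \<Rightarrow> real"
  assumes p: "equivalent_norm p" and b: "\<And>x. p x \<le> 1 \<Longrightarrow> blinfun_apply \<xi> x \<le> b"
  shows "dual_norm p \<xi> \<le> b"
  unfolding dual_norm_def
proof (rule cSUP_least)
  have n: "is_norm p" using p by (simp add: equivalent_norm_def)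
  have "p 0 = 0" using is_normD(2)[OF n] by blast
  then have "0 \<in> {x. p x \<le> 1}" by simp
  then show "{x. p x \<le> 1} \<noteq> {}" by blast
  fix x assume "x \<in> {x. p x \<le> 1}"
  then show "\<bar>blinfun_apply \<xi> x\<bar> \<le> b"
    using b[of x] b[of "- x"] is_normD(5)[OF n, of x] by (simp add: blinfun.minus_right abs_le_iff)
qed

text \<open>
  The form in which rotundity is applied below: the sequence and its limit need not lie on the unit
  sphere. Normalising changes the midpoints by at most the relative error of the norms.
\<close>
lemma LUR_unnormalised:
  assumes N: "is_norm N" and lur: "LUR N"
    and lim: "(\<lambda>n. N (Y n)) \<longlonglongrightarrow> N y" and mid: "(\<lambda>n. N (y + Y n)) \<longlonglongrightarrow> 2 * N y"
  shows "(\<lambda>n. N (Y n - y)) \<longlonglongrightarrow> 0"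
proof (cases "y = 0")
  case True
  then show ?thesis using lim is_normD(2)[OF N, of 0] by simp
next
  case False
  note nonneg = is_normD(1)[OF N] and zero = is_normD(2)[OF N] and scale = is_normD(3)[OF N]
    and tri = is_normD(4)[OF N] and Nm = is_normD(6)[OF N]
  define a where "a = N y"
  have a: "0 < a" unfolding a_def using False by (rule is_normD(7)[OF N])
  define u where "u = (1 / a) *\<^sub>R y"
  \<comment> \<open>\<open>u\<close> is a harmless unit vector for the finitely many \<open>n\<close> with \<open>Y n = 0\<close>.\<close>
  define u' where "u' n = (if N (Y n) = 0 then u else (1 / N (Y n)) *\<^sub>R Y n)" for n
  have Nu: "N u = 1" unfolding u_def scale using a by (simp add: a_def)
  have Nu': "N (u' n) = 1" for n unfolding u'_def using Nu nonneg[of "Y n"] by (simp add: scale)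
  have split: "Y n = N (Y n) *\<^sub>R u' n" for n unfolding u'_def using zero by auto
  have quot: "(\<lambda>n. 1 - N (Y n) / a) \<longlonglongrightarrow> 0"
    using tendsto_diff[OF tendsto_const tendsto_divide[OF lim tendsto_const, of a], of 1] a
    by (simp add: a_def)
  have "(\<lambda>n. N (u + u' n) - N ((1 / a) *\<^sub>R (y + Y n))) \<longlonglongrightarrow> 0"
  proof (rule Lim_null_comparison[OF always_eventually])
    show "(\<lambda>n. \<bar>1 - N (Y n) / a\<bar>) \<longlonglongrightarrow> 0" using tendsto_rabs[OF quot] by simp
    show "\<forall>n. norm (N (u + u' n) - N ((1 / a) *\<^sub>R (y + Y n))) \<le> \<bar>1 - N (Y n) / a\<bar>"
    proof
      fix n
      let ?v = "u + u' n" and ?w = "(1 / a) *\<^sub>R (y + Y n)"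
      have "?v - ?w = u' n - (1 / a) *\<^sub>R Y n"
        by (simp add: u_def algebra_simps)
      also have "\<dots> = u' n - (1 / a) *\<^sub>R (N (Y n) *\<^sub>R u' n)" using split[of n] by simp
      also have "\<dots> = (1 - N (Y n) / a) *\<^sub>R u' n" by (simp add: algebra_simps)
      finally have "N (?v - ?w) = \<bar>1 - N (Y n) / a\<bar>" using scale Nu' by simp
      moreover have "N ?v \<le> N (?v - ?w) + N ?w" using tri[of "?v - ?w" ?w] by simp
      moreover have "N ?w \<le> N (?v - ?w) + N ?v" using tri[of "?w - ?v" ?v] Nm[of ?w ?v] by simp
      ultimately show "norm (N ?v - N ?w) \<le> \<bar>1 - N (Y n) / a\<bar>" by simp
    qed
  qed
  moreover have "(\<lambda>n. N ((1 / a) *\<^sub>R (y + Y n))) \<longlonglongrightarrow> 2"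
    unfolding scale using tendsto_mult[OF tendsto_const mid, of "\<bar>1 / a\<bar>"] a by (simp add: a_def)
  ultimately have "(\<lambda>n. N (u + u' n)) \<longlonglongrightarrow> 2"
    using tendsto_add[of _ 0 sequentially _ 2] by fastforce
  then have u: "(\<lambda>n. N (u' n - u)) \<longlonglongrightarrow> 0"
    using lur Nu Nu' unfolding LUR_def by blast
  show ?thesis
  proof (rule Lim_null_comparison[OF always_eventually])
    show "(\<lambda>n. \<bar>N (Y n) - a\<bar> + a * N (u' n - u)) \<longlonglongrightarrow> 0"
      using tendsto_add[OF tendsto_rabs[OF tendsto_diff[OF lim tendsto_const, of a]]
          tendsto_mult[OF tendsto_const u, of a]] by (simp add: a_def)
    show "\<forall>n. norm (N (Y n - y)) \<le> \<bar>N (Y n) - a\<bar> + a * N (u' n - u)"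
    proof
      fix n
      have "y = a *\<^sub>R u" using a by (simp add: u_def)
      then have "Y n - y = (N (Y n) - a) *\<^sub>R u' n + a *\<^sub>R (u' n - u)"
        using split[of n] by (metis (no_types, lifting) diff_add_cancel scaleR_left_diff_distrib scaleR_right_diff_distrib add_diff_eq)
      then have "N (Y n - y) \<le> \<bar>N (Y n) - a\<bar> * N (u' n) + \<bar>a\<bar> * N (u' n - u)"
        using tri scale by metis
      then show "norm (N (Y n - y)) \<le> \<bar>N (Y n) - a\<bar> + a * N (u' n - u)"
        using Nu' a nonneg by simp
    qed
  qed
qed

section \<open>Infimal convolution\<close>

definition infimal_convolution ::
    "'a::real_normed_vector set \<Rightarrow> ('a \<Rightarrow> real) \<Rightarrow> ('a \<Rightarrow> real) \<Rightarrow> 'a \<Rightarrow> real" where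
  "infimal_convolution U f k x = (INF y\<in>U. f y + k (x - y))"

lemma infimal_convolution_upper:
  assumes "\<And>y. y \<in> U \<Longrightarrow> b \<le> f y + k (x - y)" and "y \<in> U"
  shows "infimal_convolution U f k x \<le> f y + k (x - y)"
  unfolding infimal_convolution_def using assms by (intro cINF_lower bdd_belowI2[where m = b]) auto

lemma infimal_convolution_greatest:
  assumes "\<And>y. y \<in> U \<Longrightarrow> b \<le> f y + k (x - y)" and "U \<noteq> {}"
  shows "b \<le> infimal_convolution U f k x"
  unfolding infimal_convolution_def using assms by (intro cINF_greatest) auto

lemma infimal_convolution_approx:
  assumes "U \<noteq> {}" and "0 < e"
  shows "\<exists>y\<in>U. f y + k (x - y) < infimal_convolution U f k x + e"
proof (rule ccontr)
  assume "\<not> ?thesis"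
  then have "infimal_convolution U f k x + e \<le> infimal_convolution U f k x"
    using assms(1) by (intro infimal_convolution_greatest) (auto simp: not_less)
  then show False using assms(2) by simp
qed

text \<open>
  Convex combinations of near minimisers at \<open>x1\<close> and \<open>x2\<close> are admissible competitors at the
  convex combination of \<open>x1\<close> and \<open>x2\<close>.
\<close>
lemma convex_on_infimal_convolution:
  fixes U :: "'a::real_normed_vector set"
  assumes U: "U \<noteq> {}" and f: "convex_on U f" and k: "convex_on UNIV k"
    and b: "\<And>x. \<exists>b. \<forall>y\<in>U. b \<le> f y + k (x - y)"
  shows "convex_on UNIV (infimal_convolution U f k)" (is "convex_on UNIV ?G")
  unfolding convex_on_def
proof (intro conjI ballI allI impI)
  fix x1 x2 :: 'a and u v :: real
  assume uv: "0 \<le> u" "0 \<le> v" "u + v = 1"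
  let ?z = "u *\<^sub>R x1 + v *\<^sub>R x2"
  show "?G ?z \<le> u * ?G x1 + v * ?G x2"
  proof (rule field_le_epsilon)
    fix e :: real assume e: "0 < e"
    obtain y1 where y1: "y1 \<in> U" "f y1 + k (x1 - y1) < ?G x1 + e"
      using infimal_convolution_approx[OF U e] by blast
    obtain y2 where y2: "y2 \<in> U" "f y2 + k (x2 - y2) < ?G x2 + e"
      using infimal_convolution_approx[OF U e] by blast
    let ?y = "u *\<^sub>R y1 + v *\<^sub>R y2"
    have y: "?y \<in> U" using f y1(1) y2(1) uv unfolding convex_on_def convex_def by blast
    obtain b where "\<forall>y\<in>U. b \<le> f y + k (?z - y)" using b by blast
    then have "?G ?z \<le> f ?y + k (?z - ?y)" using y by (intro infimal_convolution_upper) auto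
    also have "?z - ?y = u *\<^sub>R (x1 - y1) + v *\<^sub>R (x2 - y2)" by (simp add: algebra_simps)
    also have "f ?y + k \<dots> \<le> (u * f y1 + v * f y2) + (u * k (x1 - y1) + v * k (x2 - y2))"
      using f k y1(1) y2(1) uv unfolding convex_on_def by (intro add_mono) auto
    also have "\<dots> = u * (f y1 + k (x1 - y1)) + v * (f y2 + k (x2 - y2))" by (simp add: algebra_simps)
    also have "\<dots> \<le> u * (?G x1 + e) + v * (?G x2 + e)"
      using y1(2) y2(2) uv by (intro add_mono[OF mult_left_mono mult_left_mono]) auto
    also have "\<dots> = (u * ?G x1 + v * ?G x2) + (u + v) * e" by (simp add: algebra_simps)
    finally show "?G ?z \<le> u * ?G x1 + v * ?G x2 + e" using uv by simp
  qed
qed simp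

section \<open>Smoothing a Lipschitz convex function\<close>

text \<open>
  The Moreau envelope of \<open>h\<close>, formed with the norm \<open>p\<close>.
\<close>
definition envelope :: "('a::real_normed_vector \<Rightarrow> real) \<Rightarrow> real \<Rightarrow> ('a \<Rightarrow> real) \<Rightarrow> 'a \<Rightarrow> real" where
  "envelope p c h = infimal_convolution UNIV h (\<lambda>w. c * (p w)\<^sup>2)"

lemma convex_on_square_norm:
  assumes p: "is_norm p" and c: "0 \<le> c"
  shows "convex_on UNIV (\<lambda>w. c * (p w)\<^sup>2)"
  unfolding convex_on_def
proof (intro conjI ballI allI impI)
  fix x y and u v :: real
  assume uv: "0 \<le> u" "0 \<le> v" "u + v = 1"
  have "p (u *\<^sub>R x + v *\<^sub>R y) \<le> u * p x + v * p y"
    using is_normD(4)[OF p, of "u *\<^sub>R x" "v *\<^sub>R y"] uv by (simp add: is_normD(3)[OF p])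
  then have "(p (u *\<^sub>R x + v *\<^sub>R y))\<^sup>2 \<le> (u * p x + v * p y)\<^sup>2"
    using is_normD(1)[OF p] by (intro power_mono) auto
  also have "\<dots> = (u + v) * (u * (p x)\<^sup>2 + v * (p y)\<^sup>2) - u * v * (p x - p y)\<^sup>2"
    by (simp add: power2_eq_square algebra_simps)
  also have "\<dots> \<le> u * (p x)\<^sup>2 + v * (p y)\<^sup>2" using uv by simp
  finally have "c * (p (u *\<^sub>R x + v *\<^sub>R y))\<^sup>2 \<le> c * (u * (p x)\<^sup>2 + v * (p y)\<^sup>2)"
    using c by (rule mult_left_mono)
  then show "c * (p (u *\<^sub>R x + v *\<^sub>R y))\<^sup>2 \<le> u * (c * (p x)\<^sup>2) + v * (c * (p y)\<^sup>2)"
    by (simp add: algebra_simps)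
qed simp

text \<open>
  Completing the square: the quadratic penalty outweighs the linear gain up to \<open>L\<^sup>2 / (4 * c)\<close>.
\<close>
lemma envelope_minorant:
  fixes p :: "'a::real_normed_vector \<Rightarrow> real" and c :: real
  assumes c: "0 < c" and h: "h x \<le> h y + L * p (x - y)"
  shows "h x - L\<^sup>2 / (4 * c) \<le> h y + c * (p (x - y))\<^sup>2"
proof -
  have "0 \<le> (L - 2 * c * p (x - y))\<^sup>2 / (4 * c)" using c by simp
  also have "\<dots> = L\<^sup>2 / (4 * c) - L * p (x - y) + c * (p (x - y))\<^sup>2"
    using c by (simp add: power2_eq_square field_simps)
  finally show ?thesis using h by simp
qed

lemma envelope_upper:
  assumes c: "0 < c" and h: "\<And>x y. h x \<le> h y + L * p (x - y)"
  shows "envelope p c h x \<le> h y + c * (p (x - y))\<^sup>2"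
  unfolding envelope_def
proof (rule infimal_convolution_upper)
  show "h x - L\<^sup>2 / (4 * c) \<le> h y + c * (p (x - y))\<^sup>2" for y
    by (rule envelope_minorant[OF c], rule h)
qed simp

lemma envelope_bounds:
  assumes p: "is_norm p" and c: "0 < c" and h: "\<And>x y. h x \<le> h y + L * p (x - y)"
  shows "h x - L\<^sup>2 / (4 * c) \<le> envelope p c h x" and "envelope p c h x \<le> h x"
proof -
  show "h x - L\<^sup>2 / (4 * c) \<le> envelope p c h x"
    unfolding envelope_def
  proof (rule infimal_convolution_greatest)
    show "h x - L\<^sup>2 / (4 * c) \<le> h y + c * (p (x - y))\<^sup>2" for y
      by (rule envelope_minorant[OF c], rule h)
  qed simp
  have "envelope p c h x \<le> h x + c * (p (x - x))\<^sup>2" using c h by (rule envelope_upper)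
  then show "envelope p c h x \<le> h x" using is_normD(2)[OF p, of 0] by simp
qed

lemma convex_on_envelope:
  assumes p: "is_norm p" and c: "0 < c" and h: "\<And>x y. h x \<le> h y + L * p (x - y)"
    and conv: "convex_on UNIV h"
  shows "convex_on UNIV (envelope p c h)"
  unfolding envelope_def
proof (rule convex_on_infimal_convolution)
  fix x
  have "h x - L\<^sup>2 / (4 * c) \<le> h y + c * (p (x - y))\<^sup>2" for y
    by (rule envelope_minorant[OF c], rule h)
  then show "\<exists>b. \<forall>y\<in>UNIV. b \<le> h y + c * (p (x - y))\<^sup>2" by blast
qed (use conv c convex_on_square_norm[OF p, of c] in auto)

text \<open>
  Translating a competitor for \<open>x'\<close> by \<open>x - x'\<close> leaves its penalty unchanged.
\<close>
lemma envelope_Lipschitz: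
  assumes c: "0 < c" and h: "\<And>x y. h x \<le> h y + L * p (x - y)"
  shows "envelope p c h x \<le> envelope p c h x' + L * p (x - x')"
proof (rule field_le_epsilon)
  fix e :: real assume "0 < e"
  then obtain y where y: "h y + c * (p (x' - y))\<^sup>2 < envelope p c h x' + e"
    unfolding envelope_def using infimal_convolution_approx[of UNIV e h "\<lambda>w. c * (p w)\<^sup>2" x'] by auto
  have "envelope p c h x \<le> h (y + (x - x')) + c * (p (x - (y + (x - x'))))\<^sup>2"
    using c h by (rule envelope_upper)
  also have "x - (y + (x - x')) = x' - y" by simp
  also have "h (y + (x - x')) \<le> h y + L * p (x - x')"
    using h[of "y + (x - x')" y] by simp
  finally show "envelope p c h x \<le> envelope p c h x' + L * p (x - x') + e" using y by simp
qed

text \<open>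
  The core of the smoothing argument. Since \<open>F (y + u) \<le> h y + c * (p u)\<^sup>2\<close>, with near equality at
  \<open>u = x - y\<close>, an approximate subgradient of the envelope \<open>F\<close> at \<open>x\<close> is one of \<open>c * p\<^sup>2\<close> at \<open>x - y\<close>.
  As \<open>N\<^sup>2 / (4 * c)\<close> is the convex conjugate of \<open>c * p\<^sup>2\<close>, the two nearly satisfy Young's equality,
  whose defect dominates the square on the left-hand side.
\<close>
lemma approximate_subgradient_dual_norm:
  fixes p :: "'a::real_normed_vector \<Rightarrow> real"
  assumes p: "equivalent_norm p" and N: "is_norm (dual_norm p)" and c: "0 < c"
    and h: "\<And>x y. h x \<le> h y + L * p (x - y)"
    and \<xi>: "subgradient (envelope p c h) x e \<xi>"
    and y: "h y + c * (p (x - y))\<^sup>2 \<le> envelope p c h x + \<eta>"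
  shows "(dual_norm p \<xi> - 2 * c * p (x - y))\<^sup>2 \<le> 4 * c * (e + \<eta>)"
proof -
  let ?F = "envelope p c h"
  define w where "w = x - y"
  define n where "n = dual_norm p \<xi>"
  \<comment> \<open>\<open>s\<close> maximises \<open>s * n - c * s\<^sup>2\<close>; the conjugate is approached along vectors of \<open>p\<close>-norm \<open>s\<close>.\<close>
  define s where "s = n / (2 * c)"
  have pn: "is_norm p" using p by (simp add: equivalent_norm_def)
  have s: "0 \<le> s" unfolding s_def n_def using c is_normD(1)[OF N] by simp
  have \<xi>w: "blinfun_apply \<xi> w \<le> n * p w" unfolding n_def using dual_norm_ge[OF p, of \<xi> w] by simp
  have quad: "c * (p w)\<^sup>2 + blinfun_apply \<xi> u - blinfun_apply \<xi> w \<le> c * (p u)\<^sup>2 + (e + \<eta>)" for u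
  proof -
    have "?F x + blinfun_apply \<xi> ((y + u) - x) - e \<le> ?F (y + u)"
      using \<xi> unfolding subgradient_def by blast
    also have "?F (y + u) \<le> h y + c * (p (y + u - y))\<^sup>2" using c h by (rule envelope_upper)
    finally have "?F x + (blinfun_apply \<xi> u - blinfun_apply \<xi> w) - e \<le> h y + c * (p u)\<^sup>2"
      by (simp add: w_def blinfun.diff_right blinfun.add_right)
    then show ?thesis using y by (simp add: w_def)
  qed
  have "s * n + c * (p w)\<^sup>2 \<le> c * s\<^sup>2 + (e + \<eta>) + n * p w"
  proof (cases "s = 0")
    case True
    then show ?thesis using quad[of 0] \<xi>w is_normD(2)[OF pn, of 0] by simp
  next
    case False
    have "n \<le> (c * s\<^sup>2 + (e + \<eta>) - c * (p w)\<^sup>2 + blinfun_apply \<xi> w) / s"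
      unfolding n_def
    proof (rule dual_norm_least[OF p])
      fix v assume v: "p v \<le> 1"
      have "(p (s *\<^sub>R v))\<^sup>2 \<le> s\<^sup>2"
        using s v is_normD(1)[OF pn, of v] is_normD(3)[OF pn, of s v]
        by (intro power_mono) (auto intro: mult_left_le)
      then have "c * (p (s *\<^sub>R v))\<^sup>2 \<le> c * s\<^sup>2" using c by simp
      then have "c * (p w)\<^sup>2 + s * blinfun_apply \<xi> v - blinfun_apply \<xi> w \<le> c * s\<^sup>2 + (e + \<eta>)"
        using quad[of "s *\<^sub>R v"] by (simp add: blinfun.scaleR_right)
      then show "blinfun_apply \<xi> v \<le> (c * s\<^sup>2 + (e + \<eta>) - c * (p w)\<^sup>2 + blinfun_apply \<xi> w) / s"
        using s False by (simp add: pos_le_divide_eq algebra_simps)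
    qed
    then have "s * n \<le> c * s\<^sup>2 + (e + \<eta>) - c * (p w)\<^sup>2 + blinfun_apply \<xi> w"
      using s False by (simp add: pos_le_divide_eq algebra_simps)
    then show ?thesis using \<xi>w by simp
  qed
  then have "4 * c * (s * n + c * (p w)\<^sup>2) \<le> 4 * c * (c * s\<^sup>2 + (e + \<eta>) + n * p w)"
    using c by (intro mult_left_mono) auto
  moreover have "4 * c * (s * n) = 2 * n\<^sup>2" "4 * c * (c * s\<^sup>2) = n\<^sup>2"
    unfolding s_def using c by (simp_all add: power2_eq_square field_simps)
  ultimately have "n\<^sup>2 + 4 * c * (c * (p w)\<^sup>2) - 4 * c * (n * p w) \<le> 4 * c * (e + \<eta>)"
    by (simp add: distrib_left)
  then show ?thesis
    unfolding n_def w_def by (simp add: power2_eq_square algebra_simps)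
qed

text \<open>
  A subgradient at \<open>y\<close> is a subgradient at any other point \<open>x\<close> at the price of an error, which is
  small when \<open>y\<close> is close to \<open>x\<close> and \<open>F\<close> is continuous.
\<close>
lemma subgradient_shift:
  assumes "subgradient F y 0 \<zeta>"
  shows "subgradient F x (F x - F y + blinfun_apply \<zeta> (y - x)) \<zeta>"
  unfolding subgradient_def
proof
  fix z
  have "F y + blinfun_apply \<zeta> (z - y) - 0 \<le> F z" using assms unfolding subgradient_def by blast
  then show "F x + blinfun_apply \<zeta> (z - x) - (F x - F y + blinfun_apply \<zeta> (y - x)) \<le> F z"
    by (simp add: blinfun.diff_right)
qed

lemma subgradient_mono:
  assumes "subgradient F x e \<zeta>" and "e \<le> e'"
  shows "subgradient F x e' \<zeta>"
  using assms unfolding subgradient_def by (meson diff_left_mono order_trans)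

lemma subgradient_midpoint:
  assumes "subgradient F x e \<zeta>" and "subgradient F x e \<zeta>'"
  shows "subgradient F x e ((1 / 2) *\<^sub>R (\<zeta> + \<zeta>'))"
  unfolding subgradient_def
proof
  fix z
  have "F x + blinfun_apply \<zeta> (z - x) - e \<le> F z" "F x + blinfun_apply \<zeta>' (z - x) - e \<le> F z"
    using assms unfolding subgradient_def by auto
  moreover have "blinfun_apply ((1 / 2) *\<^sub>R (\<zeta> + \<zeta>')) (z - x)
      = (blinfun_apply \<zeta> (z - x) + blinfun_apply \<zeta>' (z - x)) / 2"
    by (simp add: blinfun.scaleR_left blinfun.add_left)
  ultimately show "F x + blinfun_apply ((1 / 2) *\<^sub>R (\<zeta> + \<zeta>')) (z - x) - e \<le> F z"
    by simp
qed

text \<open>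
  Along a sequence \<open>X n \<longlonglongrightarrow> x\<close>, the lemma \<open>approximate_subgradient_dual_norm\<close> pins the dual norms of
  \<open>\<xi> x\<close>, \<open>\<xi> (X n)\<close> and of their midpoint to one common number for each \<open>n\<close>. This is exactly the
  situation in which local uniform rotundity yields convergence.
\<close>
lemma envelope_subgradient_continuous:
  fixes p :: "'a::real_normed_vector \<Rightarrow> real"
  assumes p: "equivalent_norm p" and N: "equivalent_norm (dual_norm p)" and lur: "LUR (dual_norm p)"
    and c: "0 < c" and h: "\<And>x y. h x \<le> h y + L * p (x - y)" and L: "0 \<le> L"
    and \<xi>: "\<And>x. subgradient (envelope p c h) x 0 (\<xi> x)" and M: "\<And>x. norm (\<xi> x) \<le> M"
  shows "continuous_on UNIV \<xi>"
  unfolding continuous_on_sequentially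
proof (intro ballI allI impI)
  fix X :: "nat \<Rightarrow> 'a" and x
  assume "(\<forall>n. X n \<in> UNIV) \<and> X \<longlonglongrightarrow> x"
  then have X: "X \<longlonglongrightarrow> x" by simp
  let ?F = "envelope p c h" and ?N = "dual_norm p"
  have pn: "is_norm p" and Nn: "is_norm ?N" using p N by (simp_all add: equivalent_norm_def)
  obtain b where b: "0 < b" "\<And>x. p x \<le> b * norm x" using equivalent_norm_bounds(2)[OF p] by blast
  obtain a where a: "0 < a" "\<And>\<zeta>. a * norm \<zeta> \<le> ?N \<zeta>" using equivalent_norm_bounds(1)[OF N] by blast
  have Xn: "(\<lambda>n. norm (X n - x)) \<longlonglongrightarrow> 0" using X by (simp add: LIM_zero tendsto_norm_zero)
  define e where "e n = ?F x - ?F (X n) + blinfun_apply (\<xi> (X n)) (X n - x)" for n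
  have e0: "0 \<le> e n" for n
    using \<xi>[of "X n"] unfolding subgradient_def e_def by (simp add: blinfun.diff_right algebra_simps)
  have e: "e \<longlonglongrightarrow> 0"
  proof (rule Lim_null_comparison[OF always_eventually])
    show "\<forall>n. norm (e n) \<le> (L * b + M) * norm (X n - x)"
    proof
      fix n
      have "?F x - ?F (X n) \<le> L * p (x - X n)"
        using envelope_Lipschitz[of c h L p x "X n", OF c h] by simp
      also have "\<dots> \<le> L * (b * norm (X n - x))"
        using L b(2)[of "X n - x"] is_normD(6)[OF pn, of x "X n"] by (simp add: mult_left_mono)
      finally have "?F x - ?F (X n) \<le> L * b * norm (X n - x)" by simp
      moreover have "blinfun_apply (\<xi> (X n)) (X n - x) \<le> M * norm (X n - x)"
        using norm_blinfun[of "\<xi> (X n)" "X n - x"] mult_right_mono[OF M[of "X n"], of "norm (X n - x)"]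
        by simp
      ultimately show "norm (e n) \<le> (L * b + M) * norm (X n - x)"
        using e0[of n] unfolding e_def by (simp add: distrib_right)
    qed
    show "(\<lambda>n. (L * b + M) * norm (X n - x)) \<longlonglongrightarrow> 0"
      using tendsto_mult[OF tendsto_const Xn, of "L * b + M"] by simp
  qed
  have "\<exists>y. h y + c * (p (x - y))\<^sup>2 \<le> ?F x + inverse (real (Suc n))" for n
    using infimal_convolution_approx[of UNIV "inverse (real (Suc n))" h "\<lambda>w. c * (p w)\<^sup>2" x]
    unfolding envelope_def by (auto intro: less_imp_le)
  then obtain Y where Y: "\<And>n. h (Y n) + c * (p (x - Y n))\<^sup>2 \<le> ?F x + inverse (real (Suc n))"
    by metis
  define r where "r n = sqrt (4 * c * (e n + inverse (real (Suc n))))" for n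
  have "r \<longlonglongrightarrow> sqrt (4 * c * (0 + 0))"
    unfolding r_def by (intro tendsto_intros e LIMSEQ_inverse_real_of_nat)
  then have r: "r \<longlonglongrightarrow> 0" by simp
  have close: "\<bar>?N \<zeta> - 2 * c * p (x - Y n)\<bar> \<le> r n" if "subgradient ?F x (e n) \<zeta>" for n \<zeta>
    unfolding r_def
    using approximate_subgradient_dual_norm[OF p Nn c h that Y[of n]] real_sqrt_le_mono by fastforce
  have sx: "subgradient ?F x (e n) (\<xi> x)" for n
    using subgradient_mono[OF \<xi> e0] .
  have sX: "subgradient ?F x (e n) (\<xi> (X n))" for n
    unfolding e_def by (rule subgradient_shift) (rule \<xi>)
  have two_r: "(\<lambda>n. 4 * r n) \<longlonglongrightarrow> 0" using tendsto_mult[OF tendsto_const r, of 4] by simp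
  have "(\<lambda>n. ?N (\<xi> (X n)) - ?N (\<xi> x)) \<longlonglongrightarrow> 0"
  proof (rule Lim_null_comparison[OF always_eventually two_r], rule allI)
    fix n
    show "norm (?N (\<xi> (X n)) - ?N (\<xi> x)) \<le> 4 * r n"
      using close[OF sx[of n]] close[OF sX[of n]] by simp
  qed
  then have lim: "(\<lambda>n. ?N (\<xi> (X n))) \<longlonglongrightarrow> ?N (\<xi> x)" by (rule LIM_zero_cancel)
  have "(\<lambda>n. ?N (\<xi> x + \<xi> (X n)) - 2 * ?N (\<xi> x)) \<longlonglongrightarrow> 0"
  proof (rule Lim_null_comparison[OF always_eventually two_r], rule allI)
    fix n
    have "?N ((1 / 2) *\<^sub>R (\<xi> x + \<xi> (X n))) = ?N (\<xi> x + \<xi> (X n)) / 2"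
      using is_normD(3)[OF Nn, of "1 / 2" "\<xi> x + \<xi> (X n)"] by simp
    then show "norm (?N (\<xi> x + \<xi> (X n)) - 2 * ?N (\<xi> x)) \<le> 4 * r n"
      using close[OF sx[of n]] close[OF subgradient_midpoint[OF sx[of n] sX[of n]]]
      by (simp add: abs_le_iff)
  qed
  then have mid: "(\<lambda>n. ?N (\<xi> x + \<xi> (X n))) \<longlonglongrightarrow> 2 * ?N (\<xi> x)" by (rule LIM_zero_cancel)
  have "(\<lambda>n. ?N (\<xi> (X n) - \<xi> x)) \<longlonglongrightarrow> 0"
    using LUR_unnormalised[OF Nn lur lim mid] .
  then have "(\<lambda>n. ?N (\<xi> (X n) - \<xi> x) / a) \<longlonglongrightarrow> 0"
    using tendsto_divide[OF _ tendsto_const, of _ 0 _ a] a(1) by fastforce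
  then have "(\<lambda>n. \<xi> (X n) - \<xi> x) \<longlonglongrightarrow> 0"
    by (rule Lim_null_comparison[OF always_eventually, rotated])
      (use a in \<open>auto simp: field_simps\<close>)
  then show "(\<xi> \<circ> X) \<longlonglongrightarrow> \<xi> x" by (simp add: LIM_zero_cancel comp_def)
qed

text \<open>
  The error of the linear approximation at \<open>x\<close> is nonnegative by the subgradient inequality at \<open>x\<close>
  and at most \<open>(\<xi> y - \<xi> x) (y - x)\<close> by the one at \<open>y\<close>.
\<close>
lemma C1_on_continuous_subgradient:
  assumes \<xi>: "\<And>x. subgradient F x 0 (\<xi> x)" and cont: "continuous_on UNIV \<xi>"
  shows "C1_on UNIV F"
  unfolding C1_on_def
proof (intro exI conjI ballI)
  show "continuous_on UNIV \<xi>" by (rule cont)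
  fix x
  show "(F has_derivative blinfun_apply (\<xi> x)) (at x)"
    unfolding has_derivative_at_alt
  proof (intro conjI allI impI)
    show "bounded_linear (blinfun_apply (\<xi> x))" by (rule blinfun.bounded_linear_right)
    fix e :: real assume "0 < e"
    then obtain d where d: "0 < d" "\<And>y. dist y x < d \<Longrightarrow> dist (\<xi> y) (\<xi> x) < e"
      using cont unfolding continuous_on_iff by (metis UNIV_I)
    show "\<exists>d>0. \<forall>y. norm (y - x) < d \<longrightarrow>
        norm (F y - F x - blinfun_apply (\<xi> x) (y - x)) \<le> e * norm (y - x)"
    proof (intro exI conjI allI impI)
      fix y assume "norm (y - x) < d"
      then have "norm (\<xi> y - \<xi> x) \<le> e" using d(2)[of y] by (simp add: dist_norm)
      then have "norm (\<xi> y - \<xi> x) * norm (y - x) \<le> e * norm (y - x)" by (rule mult_right_mono) simp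
      then have "blinfun_apply (\<xi> y) (y - x) - blinfun_apply (\<xi> x) (y - x) \<le> e * norm (y - x)"
        using norm_blinfun[of "\<xi> y - \<xi> x" "y - x"] by (simp add: blinfun.diff_left)
      moreover have "F x + blinfun_apply (\<xi> x) (y - x) - 0 \<le> F y"
        using \<xi>[of x] unfolding subgradient_def by blast
      moreover have "F y + blinfun_apply (\<xi> y) (x - y) - 0 \<le> F x"
        using \<xi>[of y] unfolding subgradient_def by blast
      ultimately show "norm (F y - F x - blinfun_apply (\<xi> x) (y - x)) \<le> e * norm (y - x)"
        by (simp add: blinfun.diff_right)
    qed (rule d(1))
  qed
qed

lemma Lipschitz_convex_C1_approximation:
  fixes h :: "'a::real_normed_vector \<Rightarrow> real"
  assumes lur: "\<exists>N :: ('a \<Rightarrow>\<^sub>L real) \<Rightarrow> real. equivalent_dual_norm N \<and> LUR N"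
    and h: "convex_on UNIV h" and L: "0 \<le> L" "\<And>x y. h x \<le> h y + L * norm (x - y)"
    and d: "0 < d"
  shows "\<exists>g. convex_on UNIV g \<and> C1_on UNIV g \<and> (\<forall>x. h x - d \<le> g x \<and> g x \<le> h x)"
proof -
  obtain p :: "'a \<Rightarrow> real" where p: "equivalent_norm p" and N: "equivalent_norm (dual_norm p)"
    and lur: "LUR (dual_norm p)"
    using lur unfolding equivalent_dual_norm_def by blast
  have pn: "is_norm p" using p by (simp add: equivalent_norm_def)
  obtain a where a: "0 < a" "\<And>x. a * norm x \<le> p x" using equivalent_norm_bounds(1)[OF p] by blast
  obtain b where b: "0 < b" "\<And>x. p x \<le> b * norm x" using equivalent_norm_bounds(2)[OF p] by blast
  define K where "K = L / a"
  have K: "0 \<le> K" using L(1) a(1) by (simp add: K_def)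
  have hp: "h x \<le> h y + K * p (x - y)" for x y
  proof -
    have "L * norm (x - y) = K * (a * norm (x - y))" using a(1) by (simp add: K_def)
    also have "\<dots> \<le> K * p (x - y)" using K a(2) by (rule mult_left_mono[rotated])
    finally show ?thesis using L(2)[of x y] by simp
  qed
  \<comment> \<open>The summand \<open>1\<close> keeps \<open>c\<close> positive when \<open>h\<close> is constant.\<close>
  define c where "c = (K\<^sup>2 + 1) / (4 * d)"
  have K1: "0 < K\<^sup>2 + 1" by (simp add: add_nonneg_pos)
  then have c: "0 < c" using d by (simp add: c_def)
  have "4 * c = (K\<^sup>2 + 1) / d" using d by (simp add: c_def field_simps)
  then have "K\<^sup>2 / (4 * c) = d * (K\<^sup>2 / (K\<^sup>2 + 1))" by simp
  also have "\<dots> \<le> d * 1" using d K1 by (intro mult_left_mono) (auto simp: field_simps)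
  finally have Kd: "K\<^sup>2 / (4 * c) \<le> d" by simp
  let ?F = "envelope p c h"
  have conv: "convex_on UNIV ?F" using convex_on_envelope[OF pn c hp h] .
  have "?F x \<le> ?F y + K * b * norm (x - y)" for x y
  proof -
    have "K * p (x - y) \<le> K * (b * norm (x - y))" using K b(2) by (rule mult_left_mono[rotated])
    then show ?thesis using envelope_Lipschitz[of c h K p x y, OF c hp] by simp
  qed
  then have "\<forall>x. \<exists>\<xi>. subgradient ?F x 0 \<xi> \<and> norm \<xi> \<le> K * b"
    using Lipschitz_convex_subgradient[OF conv] K b(1) by simp
  then obtain \<xi> where \<xi>: "\<And>x. subgradient ?F x 0 (\<xi> x)" "\<And>x. norm (\<xi> x) \<le> K * b" by metis
  have "C1_on UNIV ?F"
    using C1_on_continuous_subgradient[OF \<xi>(1)]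
      envelope_subgradient_continuous[OF p N lur c hp K \<xi>] by blast
  moreover have "h x - d \<le> ?F x \<and> ?F x \<le> h x" for x
    using envelope_bounds[OF pn c hp, of x] Kd by linarith
  ultimately show ?thesis using conv by blast
qed

section \<open>A smooth maximum\<close>

text \<open>
  A \<open>C\<^sup>1\<close> convex replacement for the positive part: it is \<open>0\<close> on \<open>t \<le> - d\<close>, it is \<open>t\<close> on
  \<open>t \<ge> d\<close>, and between them it is the parabola \<open>(t + d)\<^sup>2 / (4 * d)\<close>.
\<close>
definition ramp :: "real \<Rightarrow> real \<Rightarrow> real" where
  "ramp d t = ((max 0 (t + d))\<^sup>2 - (max 0 (t - d))\<^sup>2) / (4 * d)"

definition ramp' :: "real \<Rightarrow> real \<Rightarrow> real" where
  "ramp' d t = (max 0 (t + d) - max 0 (t - d)) / (2 * d)"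

lemma has_real_derivative_max_square:
  "((\<lambda>t::real. (max 0 t)\<^sup>2) has_real_derivative 2 * max 0 t) (at t)"
  unfolding has_field_derivative_def has_derivative_at_alt
proof (intro conjI allI impI)
  fix e :: real assume e: "0 < e"
  have "norm ((max 0 y)\<^sup>2 - (max 0 t)\<^sup>2 - 2 * max 0 t * (y - t)) \<le> \<bar>y - t\<bar> * \<bar>y - t\<bar>" for y
  proof -
    have sq: "\<bar>y - t\<bar> * \<bar>y - t\<bar> = (y - t)\<^sup>2" by (simp add: power2_eq_square abs_mult_self_eq)
    consider "0 \<le> t" "0 \<le> y" | "0 \<le> t" "y \<le> 0" | "t \<le> 0" "0 \<le> y" | "t \<le> 0" "y \<le> 0" by linarith
    then show ?thesis
    proof cases
      case 1
      then have m: "max 0 t = t" "max 0 y = y" by auto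
      have "y\<^sup>2 - t\<^sup>2 - 2 * t * (y - t) = (y - t)\<^sup>2" by (simp add: power2_eq_square algebra_simps)
      then show ?thesis unfolding sq m by simp
    next
      case 2
      then have m: "max 0 t = t" "max 0 y = 0" by auto
      have ty: "t * y \<le> 0" using 2 by (rule mult_nonneg_nonpos)
      have "0\<^sup>2 - t\<^sup>2 - 2 * t * (y - t) = t\<^sup>2 - 2 * (t * y)"
        by (simp add: power2_eq_square algebra_simps)
      moreover have "(y - t)\<^sup>2 = y\<^sup>2 + (t\<^sup>2 - 2 * (t * y))" by (simp add: power2_eq_square algebra_simps)
      moreover have "0 \<le> t\<^sup>2 - 2 * (t * y)" using ty zero_le_power2[of t] by linarith
      ultimately show ?thesis unfolding sq m by simp
    next
      case 3
      then have m: "max 0 t = 0" "max 0 y = y" by auto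
      have ty: "t * y \<le> 0" using 3 by (rule mult_nonpos_nonneg)
      have "(y - t)\<^sup>2 = y\<^sup>2 + (t\<^sup>2 - 2 * (t * y))" by (simp add: power2_eq_square algebra_simps)
      moreover have "0 \<le> t\<^sup>2 - 2 * (t * y)" using ty zero_le_power2[of t] by linarith
      ultimately show ?thesis unfolding sq m by simp
    next
      case 4
      then have m: "max 0 t = 0" "max 0 y = 0" by auto
      show ?thesis unfolding sq m by simp
    qed
  qed
  note quad = this
  show "\<exists>d>0. \<forall>y. norm (y - t) < d \<longrightarrow>
      norm ((max 0 y)\<^sup>2 - (max 0 t)\<^sup>2 - 2 * max 0 t * (y - t)) \<le> e * norm (y - t)"
  proof (intro exI conjI allI impI)
    fix y assume "norm (y - t) < e"
    then have "\<bar>y - t\<bar> * \<bar>y - t\<bar> \<le> e * \<bar>y - t\<bar>" by (intro mult_right_mono) auto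
    then show "norm ((max 0 y)\<^sup>2 - (max 0 t)\<^sup>2 - 2 * max 0 t * (y - t)) \<le> e * norm (y - t)"
      using quad[of y] by simp
  qed (rule e)
qed (rule bounded_linear_mult_right)

lemma ramp_deriv:
  assumes "0 < d"
  shows "(ramp d has_real_derivative ramp' d t) (at t)"
proof -
  have "((\<lambda>t. ((max 0 (t + d))\<^sup>2 - (max 0 (t - d))\<^sup>2) / (4 * d)) has_real_derivative
      (2 * max 0 (t + d) * (1 + 0) - 2 * max 0 (t - d) * (1 - 0)) / (4 * d)) (at t)"
    by (intro DERIV_cdivide DERIV_diff DERIV_chain2[OF has_real_derivative_max_square]
        DERIV_add DERIV_ident DERIV_const)
  moreover have "(2 * max 0 (t + d) * (1 + 0) - 2 * max 0 (t - d) * (1 - 0)) / (4 * d) = ramp' d t"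
    using assms by (simp add: ramp'_def field_simps)
  ultimately show ?thesis unfolding ramp_def[abs_def] by simp
qed

lemma ramp'_bounds:
  assumes "0 < d"
  shows "0 \<le> ramp' d t" and "ramp' d t \<le> 1" and "s \<le> t \<Longrightarrow> ramp' d s \<le> ramp' d t"
proof -
  have "max 0 (t - d) \<le> max 0 (t + d)" "max 0 (t + d) - max 0 (t - d) \<le> 2 * d"
    using assms by linarith+
  then show "0 \<le> ramp' d t" and "ramp' d t \<le> 1"
    unfolding ramp'_def using assms by (simp_all add: divide_le_eq_1)
  show "ramp' d s \<le> ramp' d t" if "s \<le> t"
  proof -
    have "max 0 (s + d) - max 0 (s - d) \<le> max 0 (t + d) - max 0 (t - d)"
      using assms that by linarith
    then show ?thesis unfolding ramp'_def using assms by (intro divide_right_mono) auto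
  qed
qed

lemma ramp_mono:
  assumes "0 < d" and "s \<le> t"
  shows "ramp d s \<le> ramp d t"
proof (rule DERIV_nonneg_imp_nondecreasing[OF assms(2)])
  show "\<exists>y. (ramp d has_real_derivative y) (at x) \<and> 0 \<le> y" for x
    using ramp_deriv[OF assms(1), of x] ramp'_bounds(1)[OF assms(1), of x] by blast
qed

lemma ramp_nonexpansive:
  assumes "0 < d" and "s \<le> t"
  shows "ramp d t - ramp d s \<le> t - s"
proof -
  have "s - ramp d s \<le> t - ramp d t"
  proof (rule DERIV_nonneg_imp_nondecreasing[OF assms(2)])
    fix x
    show "\<exists>y. ((\<lambda>x. x - ramp d x) has_real_derivative y) (at x) \<and> 0 \<le> y"
      using DERIV_diff[OF DERIV_ident ramp_deriv[OF assms(1)]] ramp'_bounds(2)[OF assms(1), of x]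
      by (intro exI[of _ "1 - ramp' d x"]) auto
  qed
  then show ?thesis by simp
qed

lemma convex_on_ramp:
  assumes d: "0 < d"
  shows "convex_on UNIV (ramp d)"
  by (rule convex_on_realI[OF connected_UNIV ramp_deriv[OF d] ramp'_bounds(3)[OF d]])

lemma ramp_bounds:
  assumes d: "0 < d"
  shows "t \<le> - d \<Longrightarrow> ramp d t = 0" and "t \<le> ramp d t" and "0 \<le> ramp d t"
    and "ramp d t \<le> max 0 t + d"
proof -
  show zero: "ramp d t = 0" if "t \<le> - d" for t
  proof -
    have "max 0 (t + d) = 0" "max 0 (t - d) = 0" using that d by linarith+
    then show ?thesis by (simp add: ramp_def)
  qed
  have id: "ramp d t = t" if "d \<le> t" for t
  proof -
    have m: "max 0 (t + d) = t + d" "max 0 (t - d) = t - d" using that d by linarith+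
    have "(t + d)\<^sup>2 - (t - d)\<^sup>2 = t * (4 * d)" by (simp add: power2_eq_square algebra_simps)
    then show ?thesis unfolding ramp_def m using d by simp
  qed
  show nonneg: "0 \<le> ramp d t" for t
    using zero[of "min t (- d)"] ramp_mono[OF d, of "min t (- d)" t] by simp
  show "t \<le> ramp d t"
    using id[of "max t d"] ramp_nonexpansive[OF d, of t "max t d"] by simp
  have "ramp d t \<le> max t d"
    using id[of "max t d"] ramp_mono[OF d, of t "max t d"] by simp
  then show "ramp d t \<le> max 0 t + d" using d by linarith
qed

text \<open>
  Exactly \<open>a\<close> or \<open>b\<close> once the two differ by at least \<open>d\<close>.
\<close>
definition smooth_max :: "real \<Rightarrow> real \<Rightarrow> real \<Rightarrow> real" where
  "smooth_max d a b = a + ramp d (b - a)"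

lemma smooth_max_bounds:
  assumes "0 < d"
  shows "b \<le> a - d \<Longrightarrow> smooth_max d a b = a" and "a \<le> smooth_max d a b"
    and "b \<le> smooth_max d a b" and "smooth_max d a b \<le> max a b + d"
  using ramp_bounds[OF assms, of "b - a"] unfolding smooth_max_def by linarith+

text \<open>
  Monotone in \<open>a\<close> because \<open>ramp\<close> has slope at most \<open>1\<close>. With convexity of \<open>ramp\<close> this makes the
  smooth maximum of convex functions convex.
\<close>
lemma smooth_max_mono:
  assumes d: "0 < d" and "a \<le> a'" and "b \<le> b'"
  shows "smooth_max d a b \<le> smooth_max d a' b'"
proof -
  have "ramp d (b - a) - ramp d (b - a') \<le> a' - a"
    using ramp_nonexpansive[OF d, of "b - a'" "b - a"] assms(2) by simp
  moreover have "ramp d (b - a') \<le> ramp d (b' - a')" using ramp_mono[OF d] assms(3) by simp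
  ultimately show ?thesis unfolding smooth_max_def by simp
qed

lemma convex_on_smooth_max:
  assumes d: "0 < d" and h: "convex_on U h" and g: "convex_on U g"
  shows "convex_on U (\<lambda>x. smooth_max d (h x) (g x))"
  unfolding convex_on_def
proof (intro conjI ballI allI impI)
  show "convex U" using h by (simp add: convex_on_def)
  fix x y and u v :: real
  assume xy: "x \<in> U" "y \<in> U" and uv: "0 \<le> u" "0 \<le> v" "u + v = 1"
  let ?z = "u *\<^sub>R x + v *\<^sub>R y"
  have "smooth_max d (h ?z) (g ?z) \<le> smooth_max d (u * h x + v * h y) (u * g x + v * g y)"
    using h g xy uv unfolding convex_on_def by (intro smooth_max_mono[OF d]) auto
  also have "\<dots> = (u * h x + v * h y) + ramp d (u * (g x - h x) + v * (g y - h y))"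
    unfolding smooth_max_def by (simp add: algebra_simps)
  also have "ramp d (u * (g x - h x) + v * (g y - h y))
      \<le> u * ramp d (g x - h x) + v * ramp d (g y - h y)"
    using convex_on_ramp[OF d] uv unfolding convex_on_def by simp
  finally show "smooth_max d (h ?z) (g ?z) \<le> u * smooth_max d (h x) (g x) + v * smooth_max d (h y) (g y)"
    unfolding smooth_max_def by (simp add: algebra_simps)
qed

lemma C1_on_subset: "C1_on U g \<Longrightarrow> V \<subseteq> U \<Longrightarrow> C1_on V g"
  unfolding C1_on_def by (meson continuous_on_subset subsetD)

lemma C1_on_smooth_max:
  fixes h g :: "'a::real_normed_vector \<Rightarrow> real"
  assumes d: "0 < d" and h: "C1_on U h" and g: "C1_on U g"
  shows "C1_on U (\<lambda>x. smooth_max d (h x) (g x))"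
proof -
  obtain h' where h': "\<And>x. x \<in> U \<Longrightarrow> (h has_derivative blinfun_apply (h' x)) (at x)"
    and ch': "continuous_on U h'" using h unfolding C1_on_def by blast
  obtain g' where g': "\<And>x. x \<in> U \<Longrightarrow> (g has_derivative blinfun_apply (g' x)) (at x)"
    and cg': "continuous_on U g'" using g unfolding C1_on_def by blast
  have ch: "continuous_on U h" and cg: "continuous_on U g"
    using h' g' by (auto intro!: continuous_at_imp_continuous_on has_derivative_continuous)
  define D where "D x = h' x + ramp' d (g x - h x) *\<^sub>R (g' x - h' x)" for x
  have "continuous_on U D"
    unfolding D_def ramp'_def using d by (intro continuous_intros ch cg ch' cg') auto
  moreover have "((\<lambda>x. smooth_max d (h x) (g x)) has_derivative blinfun_apply (D x)) (at x)"
    if x: "x \<in> U" for x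
  proof -
    have "((\<lambda>x. h x + ramp d (g x - h x)) has_derivative
        (\<lambda>v. blinfun_apply (h' x) v
          + (blinfun_apply (g' x) v - blinfun_apply (h' x) v) * ramp' d (g x - h x))) (at x)"
      by (intro has_derivative_add h' x DERIV_compose_FDERIV[OF ramp_deriv[OF d]]
          has_derivative_diff g')
    moreover have "(\<lambda>v. blinfun_apply (h' x) v
          + (blinfun_apply (g' x) v - blinfun_apply (h' x) v) * ramp' d (g x - h x)) = blinfun_apply (D x)"
      by (auto simp: D_def blinfun.add_left blinfun.scaleR_left blinfun.diff_left)
    ultimately show ?thesis unfolding smooth_max_def by simp
  qed
  ultimately show ?thesis unfolding C1_on_def by blast
qed

text \<open>
  Being \<open>C\<^sup>1\<close> is local: the derivatives of the pieces agree on overlaps because derivatives are unique.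
\<close>
lemma C1_on_UN:
  fixes G :: "'a::real_normed_vector \<Rightarrow> real" and E :: "'i \<Rightarrow> 'a set"
  assumes E: "\<And>k. open (E k)" and h: "\<And>k. C1_on (E k) (h k)"
    and eq: "\<And>k x. x \<in> E k \<Longrightarrow> G x = h k x"
  shows "C1_on (\<Union>k. E k) G"
proof -
  have "\<exists>D. (\<forall>x\<in>E k. (h k has_derivative blinfun_apply (D x)) (at x)) \<and> continuous_on (E k) D" for k
    using h unfolding C1_on_def by blast
  then obtain D where D: "\<And>k x. x \<in> E k \<Longrightarrow> (h k has_derivative blinfun_apply (D k x)) (at x)"
    and cD: "\<And>k. continuous_on (E k) (D k)" by metis
  have G: "(G has_derivative blinfun_apply (D k x)) (at x)" if "x \<in> E k" for k x
    using has_derivative_transform_within_open[OF D[OF that] E that] eq by simp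
  define G' where "G' x = D (SOME k. x \<in> E k) x" for x
  have G': "G' x = D k x" if "x \<in> E k" for k x
  proof -
    have "x \<in> E (SOME k. x \<in> E k)" using that by (rule someI)
    then show ?thesis
      unfolding G'_def using has_derivative_unique[OF G G[OF that]] by (simp add: blinfun_apply_inject)
  qed
  have "continuous_on (\<Union>k\<in>UNIV. E k) G'"
  proof (rule continuous_on_open_UN)
    fix k
    have "continuous_on (E k) G' \<longleftrightarrow> continuous_on (E k) (D k)"
      by (rule continuous_on_cong[OF refl]) (rule G')
    then show "continuous_on (E k) G'" using cD by blast
  qed (rule E)
  moreover have "(G has_derivative blinfun_apply (G' x)) (at x)" if x: "x \<in> (\<Union>k. E k)" for x
  proof -
    obtain k where k: "x \<in> E k" using x by blast
    show ?thesis unfolding G'[OF k] by (rule G[OF k])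
  qed
  ultimately show ?thesis unfolding C1_on_def by blast
qed

section \<open>Lipschitz minorants\<close>

text \<open>
  For convex \<open>f\<close> and \<open>U\<close> open, the points at which \<open>f\<close> has a subgradient of norm at most \<open>n\<close>.
  In this form they are visibly the points of \<open>U\<close> at which the infimal convolution of \<open>f\<close> with
  \<open>n * norm\<close> does not fall below \<open>f\<close>.
\<close>
definition calm_points :: "'a::real_normed_vector set \<Rightarrow> ('a \<Rightarrow> real) \<Rightarrow> real \<Rightarrow> 'a set" where
  "calm_points U f n = {x \<in> U. \<forall>y\<in>U. f x \<le> f y + n * norm (x - y)}"

lemma calm_points_mono: "m \<le> n \<Longrightarrow> calm_points U f m \<subseteq> calm_points U f n"
  unfolding calm_points_def
  by (smt (verit, best) Collect_mono mult_right_mono norm_ge_zero)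

text \<open>
  \<open>f\<close> oscillates by less than \<open>2\<close> on a ball of radius \<open>2 * r\<close> about \<open>x0\<close>. For \<open>x\<close> in the ball of
  half that radius, extend the segment from \<open>y\<close> to \<open>x\<close> by length \<open>r\<close> beyond \<open>x\<close>: along it the slope of \<open>f\<close> is
  nondecreasing, and on the added piece it is at most \<open>2 / r\<close>.
\<close>
lemma interior_calm_points:
  fixes U :: "'a::real_normed_vector set"
  assumes U: "open U" and f: "continuous_on U f" "convex_on U f" and x0: "x0 \<in> U"
  shows "\<exists>n::nat. x0 \<in> interior (calm_points U f (real n))"
proof -
  obtain d1 where d1: "0 < d1" "ball x0 d1 \<subseteq> U" using U x0 open_contains_ball by blast
  obtain d2 where d2: "0 < d2" "\<And>y. y \<in> U \<Longrightarrow> dist y x0 < d2 \<Longrightarrow> dist (f y) (f x0) < 1"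
    using f(1) x0 unfolding continuous_on_iff by (metis zero_less_one)
  define r where "r = min d1 d2 / 2"
  have r: "0 < r" using d1(1) d2(1) by (simp add: r_def)
  have near: "y \<in> U \<and> \<bar>f y - f x0\<bar> < 1" if "dist x0 y < 2 * r" for y
    using that d1(2) d2(2)[of y] by (auto simp: r_def dist_commute dist_real_def subset_iff)
  have "f x \<le> f y + (2 / r) * norm (x - y)" if x: "x \<in> ball x0 r" and y: "y \<in> U" for x y
  proof (cases "x = y")
    case False
    define D where "D = norm (x - y)"
    have D: "0 < D" using False by (simp add: D_def)
    define z where "z = x + (r / D) *\<^sub>R (x - y)"
    have "dist x z = r" using D r by (simp add: z_def dist_norm) (simp add: D_def)
    then have "dist x0 z < 2 * r" using x dist_triangle[of x0 z x] by simp
    then have z: "z \<in> U" "\<bar>f z - f x0\<bar> < 1" using near by auto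
    have fx: "\<bar>f x - f x0\<bar> < 1" using near[of x] x r by simp
    have one: "r / (r + D) + D / (r + D) = 1" using r D by (simp add: add_divide_distrib[symmetric])
    have "(r / (r + D)) *\<^sub>R y + (D / (r + D)) *\<^sub>R z
        = (r / (r + D)) *\<^sub>R y + (D / (r + D)) *\<^sub>R x + (r / (r + D)) *\<^sub>R (x - y)"
      using D by (simp add: z_def algebra_simps)
    also have "\<dots> = (r / (r + D) + D / (r + D)) *\<^sub>R x" by (simp add: algebra_simps)
    finally have "f x \<le> (r / (r + D)) * f y + (D / (r + D)) * f z"
      using f(2) y z(1) one r D unfolding convex_on_def
      by (metis add_nonneg_pos divide_nonneg_pos less_eq_real_def scaleR_one)
    then have "(r + D) * f x \<le> (r + D) * ((r / (r + D)) * f y + (D / (r + D)) * f z)"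
      using r D by (intro mult_left_mono) auto
    also have "\<dots> = r * f y + D * f z"
      using r D by (simp add: distrib_left)
    also have "D * f z \<le> D * (f x + 2)" using D z(2) fx by (intro mult_left_mono) auto
    finally have "r * f x \<le> r * f y + 2 * D" by (simp add: algebra_simps)
    then have "f x \<le> f y + 2 * D / r" using r by (simp add: field_simps)
    then show ?thesis by (simp add: D_def)
  qed simp
  then have "ball x0 r \<subseteq> calm_points U f (2 / r)"
    using near r unfolding calm_points_def by fastforce
  also have "\<dots> \<subseteq> calm_points U f (real (nat \<lceil>2 / r\<rceil>))"
    by (rule calm_points_mono) linarith
  finally have "ball x0 r \<subseteq> interior (calm_points U f (real (nat \<lceil>2 / r\<rceil>)))"
    by (intro interior_maximal) auto
  then show ?thesis using r by (meson centre_in_ball subsetD)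
qed

text \<open>
  One calm point is what keeps the infimum finite; at every calm point the infimum is attained at the
  point itself.
\<close>
lemma Lipschitz_minorant:
  fixes U :: "'a::real_normed_vector set"
  assumes f: "convex_on U f" and n: "0 \<le> n" and x0: "x0 \<in> calm_points U f n"
  defines "F \<equiv> infimal_convolution U f (\<lambda>w. n * norm w)"
  shows "convex_on UNIV F" and "F x \<le> F x' + n * norm (x - x')"
    and "z \<in> U \<Longrightarrow> F z \<le> f z" and "z \<in> calm_points U f n \<Longrightarrow> F z = f z"
proof -
  have ne: "U \<noteq> {}" using x0 by (auto simp: calm_points_def)
  have low: "f x0 - n * norm (x0 - x) \<le> f y + n * norm (x - y)" if "y \<in> U" for x y
  proof -
    have "n * norm (x0 - y) \<le> n * (norm (x0 - x) + norm (x - y))"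
      using n norm_triangle_ineq[of "x0 - x" "x - y"] by (intro mult_left_mono) auto
    then show ?thesis using x0 that unfolding calm_points_def by (fastforce simp: distrib_left)
  qed
  have upper: "F x \<le> f y + n * norm (x - y)" if "y \<in> U" for x y
    unfolding F_def
  proof (rule infimal_convolution_upper)
    show "f x0 - n * norm (x0 - x) \<le> f y + n * norm (x - y)" if "y \<in> U" for y
      using that by (rule low)
  qed (rule that)
  have "convex_on UNIV (\<lambda>w::'a. n * norm w)"
    using convex_on_cmul[OF n convex_on_dist[of UNIV "0::'a"]] by (simp add: dist_norm)
  then show "convex_on UNIV F"
    unfolding F_def using ne f low by (intro convex_on_infimal_convolution) blast+
  show "F x \<le> F x' + n * norm (x - x')" for x x'
  proof -
    have "F x - n * norm (x - x') \<le> f y + n * norm (x' - y)" if y: "y \<in> U" for y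
    proof -
      have "n * norm (x - y) \<le> n * (norm (x - x') + norm (x' - y))"
        using n norm_triangle_ineq[of "x - x'" "x' - y"] by (intro mult_left_mono) auto
      then show ?thesis using upper[OF y, of x] by (simp add: distrib_left)
    qed
    then have "F x - n * norm (x - x') \<le> infimal_convolution U f (\<lambda>w. n * norm w) x'"
      using ne by (rule infimal_convolution_greatest)
    then show ?thesis by (simp add: F_def)
  qed
  show le: "F z \<le> f z" if "z \<in> U" for z using upper[OF that, of z] by simp
  show "F z = f z" if "z \<in> calm_points U f n" for z
  proof (rule antisym)
    show "F z \<le> f z" using that le by (simp add: calm_points_def)
    show "f z \<le> F z"
      unfolding F_def using that ne by (intro infimal_convolution_greatest) (auto simp: calm_points_def)
  qed
qed

section \<open>Gluing\<close>

primrec glue :: "(nat \<Rightarrow> real) \<Rightarrow> (nat \<Rightarrow> 'a \<Rightarrow> real) \<Rightarrow> nat \<Rightarrow> 'a \<Rightarrow> real" where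
  "glue d g 0 = g 0"
| "glue d g (Suc k) = (\<lambda>x. smooth_max (d k) (glue d g k x) (g (Suc k) x))"

lemma glue_convex_C1:
  fixes g :: "nat \<Rightarrow> 'a::real_normed_vector \<Rightarrow> real"
  assumes "\<And>k. 0 < d k" and "\<And>k. convex_on U (g k)" and "\<And>k. C1_on U (g k)"
  shows "convex_on U (glue d g k)" and "C1_on U (glue d g k)"
  by (induction k) (use assms in \<open>auto intro: convex_on_smooth_max C1_on_smooth_max\<close>)

text \<open>
  The levels \<open>e * (1 - (1 / 2) ^ (k + 1))\<close> by which \<open>g k\<close> is lowered increase with \<open>k\<close> in steps of
  \<open>e * (1 / 2) ^ (k + 2)\<close>. One half of each step, \<open>e * (1 / 2) ^ (k + 3)\<close>, is the permitted
  error of \<open>g k\<close> and the other half is the smoothing width of the \<open>k\<close>-th maximum. So on \<open>E k\<close> the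
  function \<open>g (k + 1)\<close> stays too low to enter the maximum, and the partial maxima are stationary on \<open>E k\<close>
  from index \<open>k\<close> on.
\<close>
lemma convex_C1_gluing:
  fixes f :: "'a::real_normed_vector \<Rightarrow> real" and e :: real
  assumes e: "0 < e" and E: "\<And>k. open (E k)" "mono E"
    and g: "\<And>k. convex_on (\<Union>k. E k) (g k)" "\<And>k. C1_on (\<Union>k. E k) (g k)"
    and upper: "\<And>k x. x \<in> (\<Union>k. E k) \<Longrightarrow> g k x \<le> f x - e * (1 - (1 / 2) ^ (k + 1))"
    and lower: "\<And>k x. x \<in> E k \<Longrightarrow> f x - e * (1 - (1 / 2) ^ (k + 1)) - e * (1 / 2) ^ (k + 3) \<le> g k x"
  shows "\<exists>G. convex_on (\<Union>k. E k) G \<and> C1_on (\<Union>k. E k) G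
      \<and> (\<forall>x\<in>(\<Union>k. E k). f x - e \<le> G x \<and> G x \<le> f x)"
proof -
  define U where "U = (\<Union>k. E k)"
  define d where "d k = e * (1 / 2 :: real) ^ (k + 3)" for k :: nat
  define h where "h = glue d g"
  have d: "0 < d k" for k using e by (simp add: d_def)
  have h: "convex_on U (h k)" "C1_on U (h k)" for k
    unfolding h_def U_def using glue_convex_C1[of d _ g, OF d g] by blast+
  have hSuc: "h (Suc k) x = smooth_max (d k) (h k x) (g (Suc k) x)" for k x by (simp add: h_def)
  have g_le_h: "g k x \<le> h k x" for k x
    using smooth_max_bounds(3)[OF d] by (cases k) (auto simp: h_def)
  have pow: "(1 / 2 :: real) ^ (k + j) = (1 / 2) ^ k * (1 / 2) ^ j" for k j :: nat by (rule power_add)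
  have pos: "0 < (1 / 2 :: real) ^ k" and one: "(1 / 2 :: real) ^ k \<le> 1" for k :: nat
    by (simp_all add: power_le_one)
  have stable: "h (Suc k) x = h k x" if x: "x \<in> E k" for k x
  proof -
    have xU: "x \<in> (\<Union>k. E k)" using x by blast
    have "e * (1 - (1 / 2) ^ (Suc k + 1)) = e * (1 - (1 / 2) ^ (k + 1)) + 2 * d k"
      by (simp add: d_def pow eval_nat_numeral algebra_simps)
    then have "g (Suc k) x \<le> f x - e * (1 - (1 / 2) ^ (k + 1)) - 2 * d k"
      using upper[OF xU, of "Suc k"] by simp
    also have "\<dots> \<le> g k x - d k" using lower[OF x] by (simp add: d_def)
    also have "\<dots> \<le> h k x - d k" using g_le_h by simp
    finally show ?thesis unfolding hSuc by (rule smooth_max_bounds(1)[OF d])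
  qed
  have const: "h m x = h k x" if x: "x \<in> E k" and m: "k \<le> m" for k m x
    using m
  proof (induction m rule: dec_induct)
    case (step m)
    have "x \<in> E m" using E(2) x step(1) by (meson monoD subsetD)
    then show ?case using stable step by simp
  qed simp
  \<comment> \<open>Each maximum overshoots by at most \<open>d k\<close>, which is half of the room left below \<open>f\<close>.\<close>
  have h_le: "h k x \<le> f x - e * (1 / 2) ^ (k + 2)" if x: "x \<in> U" for k x
  proof (induction k)
    case 0
    show ?case using upper[of x 0] x e by (simp add: h_def U_def power2_eq_square)
  next
    case (Suc k)
    have "g (Suc k) x \<le> f x - e * (1 - (1 / 2) ^ (Suc k + 1))"
      using upper x unfolding U_def by blast
    also have "\<dots> \<le> f x - e * (1 / 2) ^ (k + 2)"
      using one[of k] e by (simp add: pow power2_eq_square)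
    finally have "max (h k x) (g (Suc k) x) \<le> f x - e * (1 / 2) ^ (k + 2)" using Suc by simp
    moreover have "e * (1 / 2) ^ (k + 2) - d k = e * (1 / 2) ^ (Suc k + 2)"
      by (simp add: d_def pow power2_eq_square eval_nat_numeral)
    ultimately show ?case
      using smooth_max_bounds(4)[OF d[of k], of "h k x" "g (Suc k) x"] unfolding hSuc by linarith
  qed
  define G where "G x = h (LEAST k. x \<in> E k) x" for x
  have G: "G x = h k x" if "x \<in> E k" for k x
    unfolding G_def using const[of x "LEAST k. x \<in> E k" k] LeastI[of "\<lambda>k. x \<in> E k", OF that]
      Least_le[of "\<lambda>k. x \<in> E k", OF that] by simp
  have "C1_on U G"
    unfolding U_def
  proof (rule C1_on_UN[OF E(1)])
    show "C1_on (E k) (h k)" for k using h(2) by (rule C1_on_subset) (auto simp: U_def)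
  qed (rule G)
  moreover have "convex_on U G"
    unfolding convex_on_def
  proof (intro conjI ballI allI impI)
    show "convex U" using h(1) by (simp add: convex_on_def)
    fix x y and u v :: real
    assume xy: "x \<in> U" "y \<in> U" and uv: "0 \<le> u" "0 \<le> v" "u + v = 1"
    let ?z = "u *\<^sub>R x + v *\<^sub>R y"
    have "?z \<in> U" using \<open>convex U\<close> xy uv by (simp add: convexD)
    then obtain i j k where "x \<in> E i" "y \<in> E j" "?z \<in> E k" using xy unfolding U_def by blast
    moreover define m where "m = max i (max j k)"
    moreover from this have "i \<le> m" "j \<le> m" "k \<le> m" by (simp_all add: m_def)
    then have "E i \<subseteq> E m" "E j \<subseteq> E m" "E k \<subseteq> E m" by (simp_all add: monoD[OF E(2)])
    ultimately have "x \<in> E m" "y \<in> E m" "?z \<in> E m" by blast+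
    then show "G ?z \<le> u * G x + v * G y"
      using G h(1)[of m] xy uv unfolding convex_on_def by simp
  qed
  moreover have "f x - e \<le> G x \<and> G x \<le> f x" if x: "x \<in> U" for x
  proof -
    obtain k where k: "x \<in> E k" using x unfolding U_def by blast
    have "e * (1 - (1 / 2) ^ (k + 1)) + e * (1 / 2) ^ (k + 3) \<le> e"
      using e pos[of k] by (simp add: pow power2_eq_square eval_nat_numeral algebra_simps)
    then have "f x - e \<le> G x" using lower[OF k] g_le_h[of k x] G[OF k] by linarith
    moreover have "G x \<le> f x"
      using h_le[OF x, of k] G[OF k] mult_pos_pos[OF e pos[of "k + 2"]] by linarith
    ultimately show ?thesis by simp
  qed
  ultimately show ?thesis unfolding U_def by blast
qed

theorem theorem1p1:
  fixes U :: "'a::banach set"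
  assumes "open U" and "convex U"
    and "\<exists>N :: ('a \<Rightarrow>\<^sub>L real) \<Rightarrow> real. equivalent_dual_norm N \<and> LUR N"
  shows "\<forall>\<epsilon>::real. \<epsilon> > 0 \<longrightarrow>
           (\<forall>f :: 'a \<Rightarrow> real. continuous_on U f \<and> convex_on U f \<longrightarrow>
              (\<exists>g :: 'a \<Rightarrow> real. convex_on U g \<and> C1_on U g \<and>
                 (\<forall>x\<in>U. f x - \<epsilon> \<le> g x \<and> g x \<le> f x)))"
proof (intro allI impI)
  fix e :: real and f :: "'a \<Rightarrow> real"
  assume e: "0 < e" and "continuous_on U f \<and> convex_on U f"
  then have f: "continuous_on U f" "convex_on U f" by simp_all
  show "\<exists>g. convex_on U g \<and> C1_on U g \<and> (\<forall>x\<in>U. f x - e \<le> g x \<and> g x \<le> f x)"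
  proof (cases "U = {}")
    case True
    then show ?thesis by (auto simp: convex_on_def C1_on_def)
  next
    case False
    then obtain x0 where "x0 \<in> U" by blast
    \<comment> \<open>For small \<open>n\<close> there may be no calm points and the infimal convolution would be \<open>- \<infinity>\<close>;
      indices start at some \<open>n0\<close> for which there is one.\<close>
    then obtain n0 :: nat where n0: "x0 \<in> calm_points U f (real n0)"
      using interior_calm_points[OF assms(1) f] interior_subset by blast
    define E where "E k = interior (calm_points U f (real (n0 + k)))" for k
    have E: "open (E k)" "mono E" for k
      unfolding E_def by (auto intro!: monoI interior_mono calm_points_mono)
    have UE: "(\<Union>k. E k) = U"
    proof
      show "(\<Union>k. E k) \<subseteq> U" unfolding E_def calm_points_def using interior_subset by blast
      show "U \<subseteq> (\<Union>k. E k)"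
      proof
        fix x assume "x \<in> U"
        then obtain n :: nat where n: "x \<in> interior (calm_points U f (real n))"
          using interior_calm_points[OF assms(1) f] by blast
        have "calm_points U f (real n) \<subseteq> calm_points U f (real (n0 + n))"
          by (rule calm_points_mono) simp
        then have "x \<in> E n" unfolding E_def using n interior_mono by blast
        then show "x \<in> (\<Union>k. E k)" by blast
      qed
    qed
    define F where "F k = infimal_convolution U f (\<lambda>w. real (n0 + k) * norm w)" for k
    have x0: "x0 \<in> calm_points U f (real (n0 + k))" for k
      using n0 calm_points_mono[of "real n0" "real (n0 + k)" U f] by auto
    have F: "convex_on UNIV (F k)" "F k x \<le> F k y + real (n0 + k) * norm (x - y)"
      "x \<in> U \<Longrightarrow> F k x \<le> f x" "x \<in> E k \<Longrightarrow> F k x = f x" for k x y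
    proof -
      have n: "0 \<le> real (n0 + k)" by simp
      note minorant = Lipschitz_minorant[OF f(2) n x0]
      show "convex_on UNIV (F k)" unfolding F_def by (rule minorant(1))
      show "F k x \<le> F k y + real (n0 + k) * norm (x - y)" unfolding F_def by (rule minorant(2))
      show "F k x \<le> f x" if "x \<in> U" unfolding F_def using that by (rule minorant(3))
      show "F k x = f x" if "x \<in> E k"
        unfolding F_def using that interior_subset unfolding E_def by (intro minorant(4)) blast
    qed
    \<comment> \<open>A subtracted constant places \<open>g k\<close> at the level required for the gluing.\<close>
    have "\<exists>g. convex_on UNIV g \<and> C1_on UNIV g
        \<and> (\<forall>x. (F k x - e * (1 - (1 / 2) ^ (k + 1))) - e * (1 / 2) ^ (k + 3) \<le> g x
            \<and> g x \<le> F k x - e * (1 - (1 / 2) ^ (k + 1)))" for k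
    proof (rule Lipschitz_convex_C1_approximation[OF assms(3)])
      show "convex_on UNIV (\<lambda>x. F k x - e * (1 - (1 / 2) ^ (k + 1)))"
        using convex_on_add[OF F(1)[of k], of "\<lambda>x. - (e * (1 - (1 / 2) ^ (k + 1)))"]
        by (simp add: convex_on_const)
      show "F k x - e * (1 - (1 / 2) ^ (k + 1))
          \<le> F k y - e * (1 - (1 / 2) ^ (k + 1)) + real (n0 + k) * norm (x - y)" for x y
        using F(2)[of k x y] by simp
    qed (use e in auto)
    then obtain g where g: "\<And>k. convex_on UNIV (g k)" "\<And>k. C1_on UNIV (g k)"
      and bounds: "\<And>k x. F k x - e * (1 - (1 / 2) ^ (k + 1)) - e * (1 / 2) ^ (k + 3) \<le> g k x"
        "\<And>k x. g k x \<le> F k x - e * (1 - (1 / 2) ^ (k + 1))"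
      by metis
    have "\<exists>G. convex_on (\<Union>k. E k) G \<and> C1_on (\<Union>k. E k) G
        \<and> (\<forall>x\<in>(\<Union>k. E k). f x - e \<le> G x \<and> G x \<le> f x)"
    proof (rule convex_C1_gluing[OF e E])
      show "convex_on (\<Union>k. E k) (g k)" for k
        unfolding UE using g(1)[of k] assms(2) by (rule convex_on_subset[OF _ subset_UNIV])
      show "C1_on (\<Union>k. E k) (g k)" for k using g(2) by (rule C1_on_subset) simp
      show "g k x \<le> f x - e * (1 - (1 / 2) ^ (k + 1))" if "x \<in> (\<Union>k. E k)" for k x
        using bounds(2)[of k x] F(3)[of x k] that unfolding UE by simp
      show "f x - e * (1 - (1 / 2) ^ (k + 1)) - e * (1 / 2) ^ (k + 3) \<le> g k x" if "x \<in> E k" for k x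
        using bounds(1)[of k x] F(4)[OF that] by simp
    qed
    then show ?thesis unfolding UE .
  qed
qed

end
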